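(* For each $a\in\mathbb{R}$ and $c\in\mathbb{C}$ define $$N_{a,c}=\Bigl\{(z_1,z_2,z_3)\in\mathbb{C}^3:\ |z_1|^2-a=|z_2|^2+a=|z_3-c|^2+|a|,\ \operatorname{Im}\bigl(z_1z_2(z_3-c)\bigr)=0,\ \operatorname{Re}\bigl(z_1z_2(z_3-c)\bigr)\ge 0\Bigr\}.$$ Then $N_{a,c}$ is a nonsingular special Lagrangian 3-fold diffeomorphic to $\mathcal{S}^1\times\mathbb{R}^2$ if $a\neq 0$, and $N_{0,c}$ is a special Lagrangian $T^2$-cone singular only at $(0,0,c)$. Define $F:\mathbb{C}^3\to\mathbb{R}\times\mathbb{C}$ by $F(z_1,z_2,z_3)=(a,b)$, where $2a=|z_1|^2-|z_2|^2$ and $$b=\begin{cases} z_3, & a=z_1=z_2=0,\\ z_3-\bar z_1\bar z_2/|z_1|, & a\ge 0,\ z_1\neq 0,\\ z_3-\bar z_1\bar z_2/|z_2|, & a<0.\end{cases}$$ Then $F^{-1}(a,c)=N_{a,c}$ for all $(a,c)\in\mathbb{R}\times\mathbb{C}$, and $F$ is a well-defined, continuous, piecewise-smooth special Lagrangian fibration of $\mathbb{C}^3$ which is not smooth on the hypersurface $\{|z_1|=|z_2|\}$.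
   Context: On $\mathbb{C}^3$ with coordinates $(z_1,z_2,z_3)$ let $\omega'=\frac{i}{2}\sum_{j=1}^3 dz_j\wedge d\bar z_j$ and $\Omega'=dz_1\wedge dz_2\wedge dz_3$. A real 3-dimensional submanifold $L$ is special Lagrangian (SL) if $\omega'|_L\equiv 0$ and $\operatorname{Im}\Omega'|_L\equiv 0$; a singular SL 3-fold is a closed subset which is an SL submanifold away from a set of singular points. An SL $T^2$-cone with vertex $p$ is a singular SL 3-fold invariant under dilations $p+t(\mathbf{z}-p)$, $t>0$, nonsingular away from $p$, whose intersection with the unit sphere about $p$ is a 2-torus. A special Lagrangian fibration of an open set $V\subseteq\mathbb{C}^3$ is a continuous surjective map from $V$ to a topological space all of whose fibres are (possibly singular) SL 3-folds. *)

theory Defs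
  imports "HOL-Analysis.Analysis"
begin

fun Ck_on :: "nat \<Rightarrow> 'a::euclidean_space set \<Rightarrow> ('a \<Rightarrow> 'b::euclidean_space) \<Rightarrow> bool" where
  "Ck_on 0 U f = continuous_on U f"
| "Ck_on (Suc k) U f =
     (f differentiable_on U \<and> (\<forall>v. Ck_on k U (\<lambda>x. frechet_derivative f (at x) v)))"

definition smooth_on :: "'a::euclidean_space set \<Rightarrow> ('a \<Rightarrow> 'b::euclidean_space) \<Rightarrow> bool" where
  "smooth_on U f \<longleftrightarrow> open U \<and> (\<forall>k. Ck_on k U f)"

definition smooth_at :: "('a::euclidean_space \<Rightarrow> 'b::euclidean_space) \<Rightarrow> 'a \<Rightarrow> bool" where
  "smooth_at f z \<longleftrightarrow> (\<exists>U. open U \<and> z \<in> U \<and> smooth_on U f)"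

definition smooth_map_on :: "'a::euclidean_space set \<Rightarrow> ('a \<Rightarrow> 'b::euclidean_space) \<Rightarrow> bool" where
  "smooth_map_on A f \<longleftrightarrow>
     (\<forall>x\<in>A. \<exists>U g. x \<in> U \<and> smooth_on U g \<and> (\<forall>y\<in>A \<inter> U. g y = f y))"

definition diffeomorphic ::
  "'a::euclidean_space set \<Rightarrow> 'b::euclidean_space set \<Rightarrow> bool" where
  "diffeomorphic A B \<longleftrightarrow>
     (\<exists>f g. homeomorphism A B f g \<and> smooth_map_on A f \<and> smooth_map_on B g)"

text \<open>The Kaehler form and holomorphic volume form of C^3, evaluated on real tangent vectors.
  omega' = i/2 sum dz_j wedge dzbar_j gives omega'(u,v) = sum_j Im(conj u_j * v_j);
  Omega' = dz_1 wedge dz_2 wedge dz_3 gives Omega'(u,v,w) = det of the matrix with rows u,v,w.\<close>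

definition omega_C3 :: "complex^3 \<Rightarrow> complex^3 \<Rightarrow> real" where
  "omega_C3 u v = (\<Sum>j\<in>UNIV. Im (cnj (u $ j) * v $ j))"

definition Omega_C3 :: "complex^3 \<Rightarrow> complex^3 \<Rightarrow> complex^3 \<Rightarrow> complex" where
  "Omega_C3 u v w = det (vector [u, v, w] :: complex^3^3)"

definition SL_submanifold :: "(complex^3) set \<Rightarrow> bool" where
  "SL_submanifold L \<longleftrightarrow>
     (\<forall>p\<in>L. \<exists>U V \<phi> \<psi>. open U \<and> p \<in> U \<and> open (V :: (real^3) set) \<and>
        smooth_on V \<phi> \<and> homeomorphism V (L \<inter> U) \<phi> \<psi> \<and>
        (\<forall>x\<in>V. inj (frechet_derivative \<phi> (at x)) \<and>
           (\<forall>a b. omega_C3 (frechet_derivative \<phi> (at x) a) (frechet_derivative \<phi> (at x) b) = 0) \<and>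
           (\<forall>a b c. Im (Omega_C3 (frechet_derivative \<phi> (at x) a) (frechet_derivative \<phi> (at x) b)
                                (frechet_derivative \<phi> (at x) c)) = 0)))"

definition singular_points :: "(complex^3) set \<Rightarrow> (complex^3) set" where
  "singular_points S = {p \<in> S. \<not> (\<exists>U. open U \<and> p \<in> U \<and> SL_submanifold (S \<inter> U))}"

definition singular_SL3 :: "(complex^3) set \<Rightarrow> bool" where
  "singular_SL3 S \<longleftrightarrow> closed S \<and> SL_submanifold (S - singular_points S)"

definition nonsingular_SL3 :: "(complex^3) set \<Rightarrow> bool" where
  "nonsingular_SL3 S \<longleftrightarrow> closed S \<and> SL_submanifold S"

definition torus2 :: "(complex \<times> complex) set" where
  "torus2 = sphere 0 1 \<times> sphere 0 1"

definition SL_T2_cone :: "complex^3 \<Rightarrow> (complex^3) set \<Rightarrow> bool" where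
  "SL_T2_cone p C \<longleftrightarrow>
     singular_SL3 C \<and>
     (\<forall>t>0. \<forall>z\<in>C. p + t *\<^sub>R (z - p) \<in> C) \<and>
     singular_points C \<subseteq> {p} \<and>
     diffeomorphic (C \<inter> sphere p 1) torus2"

definition SL_fibration ::
  "(complex^3) set \<Rightarrow> ((complex^3) \<Rightarrow> 'b::topological_space) \<Rightarrow> 'b set \<Rightarrow> bool" where
  "SL_fibration V F X \<longleftrightarrow>
     open V \<and> continuous_on V F \<and> F ` V = X \<and>
     (\<forall>y\<in>X. singular_SL3 {z \<in> V. F z = y})"

definition N_ac :: "real \<Rightarrow> complex \<Rightarrow> (complex^3) set" where
  "N_ac a c = {z. (cmod (z$1))\<^sup>2 - a = (cmod (z$2))\<^sup>2 + a \<and>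
                   (cmod (z$2))\<^sup>2 + a = (cmod (z$3 - c))\<^sup>2 + \<bar>a\<bar> \<and>
                   Im (z$1 * z$2 * (z$3 - c)) = 0 \<and> Re (z$1 * z$2 * (z$3 - c)) \<ge> 0}"

definition F_fib :: "complex^3 \<Rightarrow> real \<times> complex" where
  "F_fib z = (let a = ((cmod (z$1))\<^sup>2 - (cmod (z$2))\<^sup>2) / 2 in
     (a, if a = 0 \<and> z$1 = 0 \<and> z$2 = 0 then z$3
         else if a \<ge> 0 \<and> z$1 \<noteq> 0 then z$3 - cnj (z$1) * cnj (z$2) / complex_of_real (cmod (z$1))
         else z$3 - cnj (z$1) * cnj (z$2) / complex_of_real (cmod (z$2))))"

end

theory Submission
  imports Defs
begin

text \<open>
  With \<open>m = max |z1| |z2|\<close> the three cases of \<open>F\<close> merge into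
  \<open>F z = ((|z1|^2 - |z2|^2)/2, z3 - cnj (z1 z2)/m)\<close>, using \<open>0/0 = 0\<close>; continuity and the description of
  the fibres follow. For \<open>a \<ge> 0\<close> the part \<open>z1 \<noteq> 0\<close> of the fibre is parametrised by a unit \<open>e\<close> and
  \<open>u = z2\<close> through \<open>(e sqrt(|u|^2 + 2a), u, c + cnj (e u))\<close>. This one map gives the diffeomorphism with
  \<open>S^1 \<times> R^2\<close>, the link of the cone and, with \<open>e = e^(is)\<close>, charts on whose tangent vectors \<open>\<omega>'\<close> and
  \<open>Im \<Omega>'\<close> vanish by direct computation; exchanging \<open>z1\<close> and \<open>z2\<close> reduces \<open>a < 0\<close> to \<open>a > 0\<close>.
  If the cone were a submanifold at its vertex, all its rays would lie in one Lagrangian tangent space,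
  but \<open>\<omega>'\<close> is nonzero on the rays \<open>(1,1,1)\<close> and \<open>(i,i,-1)\<close>. Finally, where \<open>|z1| = |z2| \<noteq> 0\<close>, the
  second component of \<open>F\<close> at \<open>((1+t) z1, z2, z3)\<close> is \<open>z3 - (1 + min t 0) K\<close> with \<open>K \<noteq> 0\<close>, which has
  no derivative at \<open>t = 0\<close>.
\<close>

section \<open>Calculus of smooth maps\<close>

lemma Ck_on_cong:
  assumes "open U" "\<And>x. x \<in> U \<Longrightarrow> f x = g x"
  shows "Ck_on k U f \<longleftrightarrow> Ck_on k U g"
  using assms(2)
proof (induction k arbitrary: f g)
  case 0
  then show ?case by (simp cong: continuous_on_cong)
next
  case (Suc k)
  have "(f has_derivative D) (at x) \<longleftrightarrow> (g has_derivative D) (at x)" if "x \<in> U" for x D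
    using has_derivative_transform_within_open[OF _ assms(1) that] Suc.prems by (metis (full_types))
  then have diff: "f differentiable_on U \<longleftrightarrow> g differentiable_on U"
      and frechet: "x \<in> U \<Longrightarrow> frechet_derivative f (at x) = frechet_derivative g (at x)" for x
    unfolding differentiable_on_eq_differentiable_at[OF assms(1)] differentiable_def
      frechet_derivative_def
    by simp_all
  have "Ck_on k U (\<lambda>x. frechet_derivative f (at x) v) \<longleftrightarrow>
      Ck_on k U (\<lambda>x. frechet_derivative g (at x) v)" for v
    by (rule Suc.IH) (simp add: frechet)
  then show ?case by (simp add: diff)
qed

lemma Ck_on_SucI:
  assumes "open U" "\<And>x. x \<in> U \<Longrightarrow> (f has_derivative f' x) (at x)" "\<And>v. Ck_on k U (\<lambda>x. f' x v)"
  shows "Ck_on (Suc k) U f"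
proof -
  have "Ck_on k U (\<lambda>x. frechet_derivative f (at x) v)" for v
    by (rule Ck_on_cong[OF assms(1), THEN iffD1, OF _ assms(3)[of v]])
      (metis assms(2) frechet_derivative_at)
  then show ?thesis
    using assms(1,2) by (auto simp: differentiable_on_eq_differentiable_at differentiable_def)
qed

lemma Ck_on_Suc_has_derivative:
  assumes "Ck_on (Suc k) U f" "open U" "x \<in> U"
  shows "(f has_derivative frechet_derivative f (at x)) (at x)"
  using assms by (auto simp: differentiable_on_eq_differentiable_at frechet_derivative_works)

lemma Ck_on_Suc_imp_Ck_on:
  assumes "Ck_on (Suc k) U f"
  shows "Ck_on k U f"
  using assms
proof (induction k arbitrary: f)
  case 0
  then show ?case by (auto intro: differentiable_imp_continuous_on)
next
  case (Suc k)
  then show ?case by (metis Ck_on.simps(2))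
qed

lemma Ck_on_const: "Ck_on k U (\<lambda>x. c)"
  by (induction k arbitrary: c) (auto simp: differentiable_on_def)

lemma Ck_on_ident:
  assumes "open U"
  shows "Ck_on k U (\<lambda>x. x)"
proof (cases k)
  case (Suc k')
  then show ?thesis
    using Ck_on_SucI[OF assms has_derivative_ident] Ck_on_const by blast
qed auto

lemma Ck_on_linear:
  assumes "bounded_linear L" "open U" "Ck_on k U f"
  shows "Ck_on k U (\<lambda>x. L (f x))"
  using assms(3)
proof (induction k arbitrary: f)
  case 0
  then show ?case using bounded_linear.continuous_on[OF assms(1)] by auto
next
  case (Suc k)
  show ?case
  proof (rule Ck_on_SucI[OF assms(2)])
    show "((\<lambda>x. L (f x)) has_derivative (\<lambda>v. L (frechet_derivative f (at x) v))) (at x)" if "x \<in> U" for x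
      by (intro bounded_linear.has_derivative[OF assms(1)]
          Ck_on_Suc_has_derivative[OF Suc.prems assms(2) that])
  qed (use Suc in auto)
qed

lemma Ck_on_add:
  assumes "open U" "Ck_on k U f" "Ck_on k U g"
  shows "Ck_on k U (\<lambda>x. f x + g x)"
  using assms(2,3)
proof (induction k arbitrary: f g)
  case 0
  then show ?case by (auto intro: continuous_on_add)
next
  case (Suc k)
  show ?case
  proof (rule Ck_on_SucI[OF assms(1)])
    show "((\<lambda>x. f x + g x) has_derivative
        (\<lambda>v. frechet_derivative f (at x) v + frechet_derivative g (at x) v)) (at x)" if "x \<in> U" for x
      by (intro has_derivative_add Ck_on_Suc_has_derivative[OF _ assms(1) that]) fact+
  qed (use Suc in auto)
qed

lemma Ck_on_sum:
  assumes "open U" "finite I" "\<And>i. i \<in> I \<Longrightarrow> Ck_on k U (f i)"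
  shows "Ck_on k U (\<lambda>x. \<Sum>i\<in>I. f i x)"
  using assms(2,3)
  by (induction I rule: finite_induct) (auto intro: Ck_on_const Ck_on_add[OF assms(1)])

lemma Ck_on_bilinear:
  fixes prod :: "'b::euclidean_space \<Rightarrow> 'c::euclidean_space \<Rightarrow> 'd::euclidean_space"
  assumes "bounded_bilinear prod" "open U" "Ck_on k U f" "Ck_on k U g"
  shows "Ck_on k U (\<lambda>x. prod (f x) (g x))"
  using assms(3,4)
proof (induction k arbitrary: f g)
  case 0
  then show ?case using bounded_bilinear.continuous_on[OF assms(1)] by auto
next
  case (Suc k)
  let ?D = "\<lambda>x v. prod (f x) (frechet_derivative g (at x) v) + prod (frechet_derivative f (at x) v) (g x)"
  have "Ck_on k U f" "Ck_on k U g"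
    using Suc.prems Ck_on_Suc_imp_Ck_on by blast+
  show ?case
  proof (rule Ck_on_SucI[OF assms(2)])
    show "((\<lambda>x. prod (f x) (g x)) has_derivative ?D x) (at x)" if "x \<in> U" for x
      by (intro bounded_bilinear.FDERIV[OF assms(1)] Ck_on_Suc_has_derivative[OF _ assms(2) that]) fact+
    show "Ck_on k U (\<lambda>x. ?D x v)" for v
      by (intro Ck_on_add[OF assms(2)] Suc.IH) (use Suc.prems \<open>Ck_on k U f\<close> \<open>Ck_on k U g\<close> in auto)
  qed
qed

lemma Ck_on_compose:
  fixes f :: "'a::euclidean_space \<Rightarrow> 'b::euclidean_space" and g :: "'b \<Rightarrow> 'c::euclidean_space"
  assumes "open U" "open V" "f ` U \<subseteq> V" "Ck_on k U f" "Ck_on k V g"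
  shows "Ck_on k U (\<lambda>x. g (f x))"
  using assms(4,5)
proof (induction k arbitrary: g)
  case 0
  then show ?case using continuous_on_compose2 assms(3) by auto
next
  case (Suc k)
  \<comment> \<open>The chain rule, expanded in a basis so that it becomes a sum of products of \<open>C\<^sup>k\<close> functions.\<close>
  let ?D = "\<lambda>x v. \<Sum>i\<in>Basis. (frechet_derivative f (at x) v \<bullet> i) *\<^sub>R frechet_derivative g (at (f x)) i"
  show ?case
  proof (rule Ck_on_SucI[OF assms(1)])
    fix x assume x: "x \<in> U"
    have g: "(g has_derivative frechet_derivative g (at (f x))) (at (f x))"
      using Ck_on_Suc_has_derivative[OF Suc.prems(2) assms(2)] x assms(3) by blast
    have expand: "frechet_derivative g (at (f x)) w =
        (\<Sum>i\<in>Basis. (w \<bullet> i) *\<^sub>R frechet_derivative g (at (f x)) i)" for w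
      using has_derivative_linear[OF g]
      by (subst euclidean_representation[of w, symmetric]) (simp only: linear_sum linear_scale)
    show "((\<lambda>x. g (f x)) has_derivative ?D x) (at x)"
      by (rule has_derivative_eq_rhs[OF has_derivative_compose[OF
              Ck_on_Suc_has_derivative[OF Suc.prems(1) assms(1) x] g]], rule ext, rule expand)
  next
    fix v
    show "Ck_on k U (\<lambda>x. ?D x v)"
    proof (intro Ck_on_sum[OF assms(1)] Ck_on_bilinear[OF bounded_bilinear_scaleR assms(1)])
      fix i :: 'b assume "i \<in> Basis"
      show "Ck_on k U (\<lambda>x. frechet_derivative f (at x) v \<bullet> i)"
        using Suc.prems by (intro Ck_on_linear[OF bounded_linear_inner_left assms(1)]) auto
      show "Ck_on k U (\<lambda>x. frechet_derivative g (at (f x)) i)"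
        by (rule Suc.IH[OF Ck_on_Suc_imp_Ck_on[OF Suc.prems(1)]]) (use Suc.prems in auto)
    qed auto
  qed
qed

lemma smooth_on_open: "smooth_on U f \<Longrightarrow> open U"
  by (simp add: smooth_on_def)

lemma smooth_on_const: "open U \<Longrightarrow> smooth_on U (\<lambda>x. c)"
  by (simp add: smooth_on_def Ck_on_const)

lemma smooth_on_ident: "open U \<Longrightarrow> smooth_on U (\<lambda>x. x)"
  by (simp add: smooth_on_def Ck_on_ident)

lemma smooth_on_linear: "bounded_linear L \<Longrightarrow> smooth_on U f \<Longrightarrow> smooth_on U (\<lambda>x. L (f x))"
  by (simp add: smooth_on_def Ck_on_linear)

lemma linear_imp_smooth_on:
  fixes f :: "'a::euclidean_space \<Rightarrow> 'b::euclidean_space"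
  shows "linear f \<Longrightarrow> open U \<Longrightarrow> smooth_on U f"
  by (rule smooth_on_linear[OF _ smooth_on_ident]) (simp add: linear_conv_bounded_linear)

lemma smooth_on_add: "smooth_on U f \<Longrightarrow> smooth_on U g \<Longrightarrow> smooth_on U (\<lambda>x. f x + g x)"
  by (simp add: smooth_on_def Ck_on_add)

lemma smooth_on_diff: "smooth_on U f \<Longrightarrow> smooth_on U g \<Longrightarrow> smooth_on U (\<lambda>x. f x - g x)"
  using smooth_on_add[OF _ smooth_on_linear[OF bounded_linear_minus[OF bounded_linear_ident]], of U f g]
  by simp

lemma smooth_on_bilinear:
  fixes prod :: "'b::euclidean_space \<Rightarrow> 'c::euclidean_space \<Rightarrow> 'd::euclidean_space"
  shows "bounded_bilinear prod \<Longrightarrow> smooth_on U f \<Longrightarrow> smooth_on U g \<Longrightarrow> smooth_on U (\<lambda>x. prod (f x) (g x))"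
  by (simp add: smooth_on_def Ck_on_bilinear)

lemma smooth_on_compose:
  "smooth_on U f \<Longrightarrow> smooth_on V g \<Longrightarrow> f ` U \<subseteq> V \<Longrightarrow> smooth_on U (\<lambda>x. g (f x))"
  unfolding smooth_on_def using Ck_on_compose by blast

lemma smooth_on_subset: "smooth_on U f \<Longrightarrow> open V \<Longrightarrow> V \<subseteq> U \<Longrightarrow> smooth_on V f"
  using smooth_on_compose[OF smooth_on_ident] by fastforce

lemma smooth_on_imp_continuous_on: "smooth_on U f \<Longrightarrow> continuous_on U f"
  using Ck_on.simps(1) unfolding smooth_on_def by blast

lemma smooth_on_imp_differentiable_at: "smooth_on U f \<Longrightarrow> x \<in> U \<Longrightarrow> f differentiable at x"
  by (metis Ck_on.simps(2) differentiable_on_eq_differentiable_at smooth_on_def)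

lemmas smooth_on_mult = smooth_on_bilinear[OF bounded_bilinear_mult]
  and smooth_on_scaleR = smooth_on_bilinear[OF bounded_bilinear_scaleR]
  and smooth_on_inner = smooth_on_bilinear[OF bounded_bilinear_inner]
  and smooth_on_cnj = smooth_on_linear[OF bounded_linear_cnj]
  and smooth_on_fst = smooth_on_linear[OF bounded_linear_fst]
  and smooth_on_snd = smooth_on_linear[OF bounded_linear_snd]
  and smooth_on_vec_nth = smooth_on_linear[OF bounded_linear_vec_nth]
  and smooth_on_of_real = smooth_on_linear[OF bounded_linear_of_real]

lemma smooth_on_Pair:
  fixes f :: "'a::euclidean_space \<Rightarrow> 'b::euclidean_space" and g :: "'a \<Rightarrow> 'c::euclidean_space"
  assumes "smooth_on U f" "smooth_on U g"
  shows "smooth_on U (\<lambda>x. (f x, g x))"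
proof -
  have "smooth_on U (\<lambda>x. (f x, 0) + (0, g x))"
    by (intro smooth_on_add smooth_on_linear[OF _ assms(1)] smooth_on_linear[OF _ assms(2)]
        bounded_linear_Pair bounded_linear_zero bounded_linear_ident)
  then show ?thesis by simp
qed

lemma smooth_on_inverse:
  fixes f :: "'a::euclidean_space \<Rightarrow> 'b::{euclidean_space, real_normed_div_algebra}"
  assumes "smooth_on U f" "\<And>x. x \<in> U \<Longrightarrow> f x \<noteq> 0"
  shows "smooth_on U (\<lambda>x. inverse (f x))"
proof -
  have opn: "open {x::'b. x \<noteq> 0}" by (simp add: open_Collect_neq)
  have "Ck_on k {x::'b. x \<noteq> 0} inverse" for k
  proof (induction k)
    case (Suc k)
    show ?case
    proof (rule Ck_on_SucI[OF opn])
      show "Ck_on k {x. x \<noteq> 0} (\<lambda>x. - (inverse x * v * inverse x))" for v :: 'b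
        by (intro Ck_on_linear[OF bounded_linear_minus[OF bounded_linear_ident] opn]
            Ck_on_bilinear[OF bounded_bilinear_mult opn] Ck_on_const Suc)
    qed (auto intro: has_derivative_inverse')
  qed (auto intro!: continuous_intros)
  then show ?thesis
    by (intro smooth_on_compose[OF assms(1), of "{x. x \<noteq> 0}"])
      (use assms(2) opn in \<open>auto simp: smooth_on_def\<close>)
qed

lemma smooth_on_divide:
  fixes f :: "'a::euclidean_space \<Rightarrow> 'b::{euclidean_space, real_normed_field}"
  assumes "smooth_on U f" "smooth_on U g" "\<And>x. x \<in> U \<Longrightarrow> g x \<noteq> 0"
  shows "smooth_on U (\<lambda>x. f x / g x)"
  unfolding divide_inverse by (intro smooth_on_mult smooth_on_inverse assms)

lemma smooth_on_sqrt:
  assumes "smooth_on U f" "\<And>x. x \<in> U \<Longrightarrow> f x > 0"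
  shows "smooth_on U (\<lambda>x. sqrt (f x))"
proof -
  have opn: "open {0::real<..}" by simp
  have "Ck_on k {0<..} sqrt" for k
  proof (induction k)
    case (Suc k)
    have inv: "Ck_on k {0<..} (\<lambda>x. inverse x :: real)"
      using smooth_on_inverse[OF smooth_on_ident[OF opn]] by (simp add: smooth_on_def)
    show ?case
    proof (rule Ck_on_SucI[OF opn])
      show "(sqrt has_derivative (\<lambda>v. v / 2 * (inverse x * sqrt x))) (at x)" if "x \<in> {0<..}" for x
        using that by (auto intro!: derivative_eq_intros simp: fun_eq_iff field_simps)
      show "Ck_on k {0<..} (\<lambda>x. v / 2 * (inverse x * sqrt x))" for v :: real
        by (intro Ck_on_bilinear[OF bounded_bilinear_mult opn] Ck_on_const Suc inv)
    qed
  qed (auto intro!: continuous_intros)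
  then show ?thesis
    by (intro smooth_on_compose[OF assms(1), of "{0<..}"]) (use assms(2) in \<open>auto simp: smooth_on_def\<close>)
qed

lemma smooth_on_cis:
  assumes "smooth_on U f"
  shows "smooth_on U (\<lambda>x. cis (f x))"
proof -
  have "Ck_on k UNIV cis" for k
  proof (induction k)
    case (Suc k)
    show ?case
      by (rule Ck_on_SucI[OF open_UNIV has_derivative_cis[OF has_derivative_ident]])
        (intro Ck_on_bilinear[OF bounded_bilinear_scaleR] Ck_on_bilinear[OF bounded_bilinear_mult]
          Ck_on_const Suc open_UNIV)
  qed (auto intro!: continuous_intros)
  then show ?thesis
    by (intro smooth_on_compose[OF assms, of UNIV]) (auto simp: smooth_on_def)
qed

lemma smooth_on_norm_power2:
  fixes f :: "'a::euclidean_space \<Rightarrow> 'b::euclidean_space"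
  shows "smooth_on U f \<Longrightarrow> smooth_on U (\<lambda>x. (norm (f x))\<^sup>2)"
  unfolding power2_norm_eq_inner by (rule smooth_on_inner)

lemma smooth_on_norm:
  fixes f :: "'a::euclidean_space \<Rightarrow> 'b::euclidean_space"
  assumes "smooth_on U f" "\<And>x. x \<in> U \<Longrightarrow> f x \<noteq> 0"
  shows "smooth_on U (\<lambda>x. norm (f x))"
  unfolding norm_eq_sqrt_inner by (intro smooth_on_sqrt smooth_on_inner assms(1)) (use assms(2) in auto)

lemma smooth_on_sgn:
  fixes f :: "'a::euclidean_space \<Rightarrow> 'b::euclidean_space"
  assumes "smooth_on U f" "\<And>x. x \<in> U \<Longrightarrow> f x \<noteq> 0"
  shows "smooth_on U (\<lambda>x. sgn (f x))"
  unfolding sgn_div_norm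
  by (intro smooth_on_scaleR smooth_on_inverse smooth_on_norm assms) (use assms(2) in auto)

lemma vector_3_eq_sum_axis:
  "vector [x, y, z] = axis 1 x + axis 2 y + (axis 3 z :: 'b::real_normed_vector^3)"
  by (simp add: vec_eq_iff forall_3 axis_def)

lemma bounded_linear_axis: "bounded_linear (axis i :: 'b::euclidean_space \<Rightarrow> 'b^'n)"
  by (rule linear_conv_bounded_linear[THEN iffD1], rule linearI) (simp_all add: axis_def vec_eq_iff)

lemma has_derivative_vector_3:
  fixes f g h :: "'a::real_normed_vector \<Rightarrow> 'b::euclidean_space"
  assumes "(f has_derivative f') F" "(g has_derivative g') F" "(h has_derivative h') F"
  shows "((\<lambda>x. vector [f x, g x, h x] :: 'b^3) has_derivative (\<lambda>v. vector [f' v, g' v, h' v])) F"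
  unfolding vector_3_eq_sum_axis
  by (intro has_derivative_add bounded_linear.has_derivative[OF bounded_linear_axis] assms)

lemma smooth_on_vector_3:
  assumes "smooth_on U f" "smooth_on U g" "smooth_on U h"
  shows "smooth_on U (\<lambda>x. vector [f x, g x, h x] :: 'b::euclidean_space^3)"
  unfolding vector_3_eq_sum_axis by (intro smooth_on_add smooth_on_linear[OF bounded_linear_axis] assms)

lemmas smooth_on_intros =
  smooth_on_const smooth_on_ident smooth_on_add smooth_on_diff smooth_on_mult smooth_on_divide
  smooth_on_sqrt smooth_on_cis smooth_on_cnj smooth_on_fst smooth_on_snd smooth_on_vec_nth
  smooth_on_of_real smooth_on_norm_power2 smooth_on_norm smooth_on_sgn smooth_on_Pair smooth_on_vector_3

section \<open>Diffeomorphisms\<close>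

lemma smooth_on_imp_smooth_map_on: "smooth_on U f \<Longrightarrow> A \<subseteq> U \<Longrightarrow> smooth_map_on A f"
  unfolding smooth_map_on_def by blast

lemma smooth_map_onE:
  assumes "smooth_map_on A f" "x \<in> A"
  obtains U g where "x \<in> U" "smooth_on U g" "\<forall>y\<in>A \<inter> U. g y = f y"
  using bspec[OF assms(1)[unfolded smooth_map_on_def] assms(2)] by (elim exE conjE)

lemma smooth_map_on_subset:
  assumes "smooth_map_on A f" "B \<subseteq> A"
  shows "smooth_map_on B f"
  unfolding smooth_map_on_def
proof
  fix x assume "x \<in> B"
  then have "x \<in> A" using assms(2) by blast
  then obtain U g where "x \<in> U" "smooth_on U g" "\<forall>y\<in>A \<inter> U. g y = f y"
    by (rule smooth_map_onE[OF assms(1)])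
  then show "\<exists>U g. x \<in> U \<and> smooth_on U g \<and> (\<forall>y\<in>B \<inter> U. g y = f y)"
    using assms(2) by (intro exI[of _ U] exI[of _ g]) auto
qed

lemma smooth_map_on_imp_continuous_on:
  assumes "smooth_map_on A f"
  shows "continuous_on A f"
  unfolding continuous_on_eq_continuous_within
proof
  fix x assume "x \<in> A"
  then obtain U g where g: "x \<in> U" "smooth_on U g" "\<forall>y\<in>A \<inter> U. g y = f y"
    by (rule smooth_map_onE[OF assms])
  have "\<forall>\<^sub>F y in at x within A. g y = f y"
    unfolding eventually_at_topological using g smooth_on_open[OF g(2)] by (intro exI[of _ U]) simp
  moreover have "(g \<longlongrightarrow> g x) (at x within A)"
    using continuous_at_imp_continuous_at_within[OF differentiable_imp_continuous_within,
        OF smooth_on_imp_differentiable_at[OF g(2,1)]]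
    unfolding continuous_within .
  ultimately have "(f \<longlongrightarrow> g x) (at x within A)"
    by (rule Lim_transform_eventually[rotated])
  then show "continuous (at x within A) f"
    using g \<open>x \<in> A\<close> by (simp add: continuous_within)
qed

lemma smooth_map_on_compose:
  assumes "smooth_map_on A f" "smooth_map_on B g" "f ` A \<subseteq> B"
  shows "smooth_map_on A (g \<circ> f)"
  unfolding smooth_map_on_def
proof
  fix x assume "x \<in> A"
  then have "f x \<in> B" using assms(3) by blast
  obtain U F where F: "x \<in> U" "smooth_on U F" "\<forall>y\<in>A \<inter> U. F y = f y"
    by (rule smooth_map_onE[OF assms(1) \<open>x \<in> A\<close>])
  obtain W G where G: "f x \<in> W" "smooth_on W G" "\<forall>y\<in>B \<inter> W. G y = g y"
    by (rule smooth_map_onE[OF assms(2) \<open>f x \<in> B\<close>])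
  have "open (U \<inter> F -` W)"
    by (rule continuous_open_preimage[OF smooth_on_imp_continuous_on[OF F(2)]
          smooth_on_open[OF F(2)] smooth_on_open[OF G(2)]])
  then have "smooth_on (U \<inter> F -` W) (\<lambda>y. G (F y))"
    by (intro smooth_on_compose[OF smooth_on_subset[OF F(2)] G(2)]) auto
  moreover have "x \<in> U \<inter> F -` W" "\<forall>y\<in>A \<inter> (U \<inter> F -` W). G (F y) = (g \<circ> f) y"
    using F(1,3) G(1,3) \<open>x \<in> A\<close> assms(3) by (auto simp: image_subset_iff)
  ultimately show "\<exists>U h. x \<in> U \<and> smooth_on U h \<and> (\<forall>y\<in>A \<inter> U. h y = (g \<circ> f) y)"
    by (intro exI conjI)
qed

lemma diffeomorphic_sym: "diffeomorphic A B \<Longrightarrow> diffeomorphic B A"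
  unfolding diffeomorphic_def using homeomorphism_symD by blast

lemma diffeomorphic_trans:
  assumes "diffeomorphic A B" "diffeomorphic B C"
  shows "diffeomorphic A C"
proof -
  obtain f g where fg: "homeomorphism A B f g" "smooth_map_on A f" "smooth_map_on B g"
    using assms(1) unfolding diffeomorphic_def by blast
  obtain h k where hk: "homeomorphism B C h k" "smooth_map_on B h" "smooth_map_on C k"
    using assms(2) unfolding diffeomorphic_def by blast
  have "homeomorphism A C (h \<circ> f) (g \<circ> k)"
    using homeomorphism_compose[OF fg(1) hk(1)] .
  moreover have "smooth_map_on A (h \<circ> f)" "smooth_map_on C (g \<circ> k)"
    using fg(1) hk(1)
    by (auto intro!: smooth_map_on_compose[OF fg(2) hk(2)] smooth_map_on_compose[OF hk(3) fg(3)]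
        simp: homeomorphism_def)
  ultimately show ?thesis unfolding diffeomorphic_def by blast
qed

lemma homeomorphism_left_inverse:
  assumes "continuous_on S f" "continuous_on (f ` S) g" "\<And>x. x \<in> S \<Longrightarrow> g (f x) = x"
  shows "homeomorphism S (f ` S) f g"
  by (rule homeomorphismI) (use assms in auto)

lemma homeomorphism_Int_vimage:
  assumes "homeomorphism S T f g"
  shows "homeomorphism (S \<inter> A) (T \<inter> g -` A) f g"
  by (rule homeomorphism_of_subsets[OF assms, of _ T])
    (use assms in \<open>auto simp: homeomorphism_def image_iff\<close>)

lemma homeomorphism_map_prod:
  assumes "homeomorphism A B f g" "homeomorphism C D h k"
  shows "homeomorphism (A \<times> C) (B \<times> D) (map_prod f h) (map_prod g k)"
proof (rule homeomorphismI)
  show "continuous_on (A \<times> C) (map_prod f h)" "continuous_on (B \<times> D) (map_prod g k)"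
    using assms unfolding map_prod_def case_prod_beta homeomorphism_def
    by (auto intro!: continuous_on_Pair continuous_on_compose2[of _ _ _ fst]
        continuous_on_compose2[of _ _ _ snd] continuous_on_fst continuous_on_snd continuous_on_id)
qed (use assms in \<open>auto simp: homeomorphism_def\<close>)

lemma diffeomorphic_smooth_image:
  assumes "smooth_map_on S f" "smooth_map_on (f ` S) g" "\<And>x. x \<in> S \<Longrightarrow> g (f x) = x"
  shows "diffeomorphic S (f ` S)"
proof -
  have "homeomorphism S (f ` S) f g"
    by (intro homeomorphism_left_inverse smooth_map_on_imp_continuous_on assms)
  then show ?thesis
    unfolding diffeomorphic_def using assms(1,2) by (intro exI conjI)
qed

lemma diffeomorphic_linear_image:
  fixes f :: "'a::euclidean_space \<Rightarrow> 'b::euclidean_space"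
  assumes "linear f" "inj f"
  shows "diffeomorphic S (f ` S)"
proof -
  obtain g where g: "linear g" "g \<circ> f = id"
    using linear_injective_left_inverse[OF assms] by blast
  have "smooth_map_on S f" "smooth_map_on (f ` S) g"
    using assms(1) g(1)
    by (simp_all add: smooth_on_imp_smooth_map_on[OF linear_imp_smooth_on[OF _ open_UNIV]])
  then show ?thesis
    by (rule diffeomorphic_smooth_image) (use g(2) in \<open>auto simp: fun_eq_iff\<close>)
qed

lemma diffeomorphic_Times_linear_image:
  fixes f :: "'b::euclidean_space \<Rightarrow> 'c::euclidean_space" and A :: "'a::euclidean_space set"
  assumes "linear f" "inj f"
  shows "diffeomorphic (A \<times> B) (A \<times> f ` B)"
proof -
  let ?f = "map_prod id f :: 'a \<times> 'b \<Rightarrow> 'a \<times> 'c"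
  have "linear ?f"
    using assms(1) by (auto intro!: linearI simp: linear_add linear_scale)
  moreover have "inj ?f"
    using prod.inj_map[OF inj_on_id assms(2)] .
  moreover have "?f ` (A \<times> B) = A \<times> f ` B"
    by (rule map_prod_surj_on) simp_all
  ultimately show ?thesis
    using diffeomorphic_linear_image[of ?f "A \<times> B"] by simp
qed

section \<open>Tangent vectors of embedded sets\<close>

lemma left_inverse_remainder_within:
  fixes \<phi> :: "'a::real_normed_vector \<Rightarrow> 'b::real_normed_vector"
  assumes \<phi>: "(\<phi> has_derivative T) (at (\<psi> p))"
    and G: "bounded_linear G" "\<And>x. G (T x) = x"
    and \<psi>: "continuous (at p within M) \<psi>" "\<And>q. q \<in> M \<Longrightarrow> \<phi> (\<psi> q) = q" "p \<in> M"
    and "e > 0"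
  shows "\<forall>\<^sub>F q in at p within M. norm (\<psi> q - \<psi> p - G (q - p)) \<le> e * norm (\<psi> q - \<psi> p)"
proof -
  obtain C where C: "C > 0" "\<And>x. norm (G x) \<le> norm x * C"
    using bounded_linear.pos_bounded[OF G(1)] by blast
  have "\<forall>\<^sub>F y in nhds (\<psi> p). norm (\<phi> y - \<phi> (\<psi> p) - T (y - \<psi> p)) \<le> e / C * norm (y - \<psi> p)"
    using \<phi> C(1) \<open>e > 0\<close> unfolding has_derivative_at_alt eventually_nhds_metric dist_norm
    by (meson divide_pos_pos)
  then have "\<forall>\<^sub>F q in at p within M. norm (\<phi> (\<psi> q) - \<phi> (\<psi> p) - T (\<psi> q - \<psi> p)) \<le> e / C * norm (\<psi> q - \<psi> p)"
    using \<psi>(1) unfolding continuous_within by (rule eventually_compose_filterlim)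
  moreover have "\<forall>\<^sub>F q in at p within M. q \<in> M"
    by (simp add: eventually_at_filter)
  ultimately show ?thesis
  proof eventually_elim
    case (elim q)
    have "norm (\<psi> q - \<psi> p - G (q - p)) = norm (G (q - p - T (\<psi> q - \<psi> p)))"
      by (simp add: linear_diff[OF bounded_linear.linear[OF G(1)]] G(2) norm_minus_commute)
    also have "\<dots> \<le> norm (q - p - T (\<psi> q - \<psi> p)) * C" by (rule C(2))
    also have "\<dots> \<le> e / C * norm (\<psi> q - \<psi> p) * C"
      using elim \<psi>(2,3) C(1) by (intro mult_right_mono) simp_all
    finally show ?case using C(1) by simp
  qed
qed

lemma has_derivative_left_inverse_within:
  fixes \<phi> :: "'a::real_normed_vector \<Rightarrow> 'b::real_normed_vector"
  assumes "(\<phi> has_derivative T) (at (\<psi> p))"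
    and G: "bounded_linear G" "\<And>x. G (T x) = x"
    and "continuous (at p within M) \<psi>" "\<And>q. q \<in> M \<Longrightarrow> \<phi> (\<psi> q) = q" "p \<in> M"
  shows "(\<psi> has_derivative G) (at p within M)"
  unfolding has_derivative_within_alt2
proof (intro conjI allI impI)
  obtain C where C: "C > 0" "\<And>x. norm (G x) \<le> norm x * C"
    using bounded_linear.pos_bounded[OF G(1)] by blast
  have remainder: "\<forall>\<^sub>F q in at p within M. norm (\<psi> q - \<psi> p - G (q - p)) \<le> e * norm (\<psi> q - \<psi> p)"
    if "e > 0" for e
    by (rule left_inverse_remainder_within) (fact assms that)+
  fix e :: real assume "e > 0"
  then have "e / (2 * C) > 0" using C(1) by simp
  from remainder[OF half_gt_zero[OF zero_less_one]] remainder[OF this]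
  show "\<forall>\<^sub>F q in at p within M. norm (\<psi> q - \<psi> p - G (q - p)) \<le> e * norm (q - p)"
  proof eventually_elim
    case (elim q)
    have "norm (\<psi> q - \<psi> p) \<le> norm (G (q - p)) + 1/2 * norm (\<psi> q - \<psi> p)"
      using norm_triangle_sub[of "\<psi> q - \<psi> p" "G (q - p)"] elim(1) by linarith
    then have "norm (\<psi> q - \<psi> p) \<le> 2 * (norm (q - p) * C)"
      using C(2)[of "q - p"] by linarith
    then have "e / (2 * C) * norm (\<psi> q - \<psi> p) \<le> e / (2 * C) * (2 * (norm (q - p) * C))"
      using \<open>e > 0\<close> C(1) by (intro mult_left_mono) simp_all
    also have "\<dots> = e * norm (q - p)" using C(1) by simp
    finally show ?case using elim(2) by (rule order_trans[rotated])
  qed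
qed (rule G(1))

definition curve_tangents :: "'a::real_normed_vector set \<Rightarrow> 'a \<Rightarrow> 'a set" where
  "curve_tangents M p = {v. \<exists>\<gamma> e. e > 0 \<and> \<gamma> 0 = p \<and> \<gamma> ` {0..e} \<subseteq> M \<and>
     (\<gamma> has_vector_derivative v) (at (0::real) within {0..e})}"

lemma ray_in_curve_tangents:
  assumes "\<And>t. t \<ge> 0 \<Longrightarrow> p + t *\<^sub>R v \<in> M"
  shows "v \<in> curve_tangents M p"
proof -
  have "((\<lambda>t. p + t *\<^sub>R v) has_vector_derivative v) (at 0 within {0..1})"
    by (auto intro!: derivative_eq_intros)
  then show ?thesis
    unfolding curve_tangents_def mem_Collect_eq
    by (intro exI[of _ "\<lambda>t. p + t *\<^sub>R v"] exI[of _ 1]) (auto intro: assms)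
qed

lemma curve_tangents_Int_open:
  assumes "open U" "p \<in> U" "v \<in> curve_tangents M p"
  shows "v \<in> curve_tangents (M \<inter> U) p"
proof -
  obtain \<gamma> e where \<gamma>: "e > 0" "\<gamma> 0 = p" "\<gamma> ` {0..e} \<subseteq> M"
      "(\<gamma> has_vector_derivative v) (at 0 within {0..e})"
    using assms(3) unfolding curve_tangents_def by blast
  have "(\<gamma> \<longlongrightarrow> p) (at 0 within {0..e})"
    using has_vector_derivative_continuous[OF \<gamma>(4)] \<gamma>(2) by (simp add: continuous_within)
  then have "\<forall>\<^sub>F t in at 0 within {0..e}. \<gamma> t \<in> U"
    using assms(1,2) by (rule topological_tendstoD)
  then obtain d where d: "d > 0" "\<And>t. t \<in> {0..e} \<Longrightarrow> t \<noteq> 0 \<Longrightarrow> \<bar>t\<bar> < d \<Longrightarrow> \<gamma> t \<in> U"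
    by (auto simp: eventually_at dist_real_def)
  define r where "r = min e (d/2)"
  have r: "r > 0" "r \<le> e" "r < d" using \<gamma>(1) d(1) by (auto simp: r_def)
  have "\<gamma> ` {0..r} \<subseteq> M \<inter> U"
  proof (rule image_subsetI)
    fix t assume "t \<in> {0..r}"
    then show "\<gamma> t \<in> M \<inter> U"
      using r \<gamma>(2,3) d(2)[of t] assms(2) by (cases "t = 0") auto
  qed
  moreover have "(\<gamma> has_vector_derivative v) (at 0 within {0..r})"
    by (rule has_vector_derivative_within_subset[OF \<gamma>(4)]) (use r in auto)
  ultimately show ?thesis
    unfolding curve_tangents_def using r(1) \<gamma>(2) by blast
qed

lemma curve_tangents_subset_range_immersion:
  fixes \<phi> :: "'a::euclidean_space \<Rightarrow> 'b::euclidean_space"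
  assumes homeo: "homeomorphism V M \<phi> \<psi>" and "p \<in> M" and T: "(\<phi> has_derivative T) (at (\<psi> p))" "inj T"
  shows "curve_tangents M p \<subseteq> range T"
proof
  fix v assume "v \<in> curve_tangents M p"
  then obtain \<gamma> e where \<gamma>: "e > 0" "\<gamma> 0 = p" "\<gamma> ` {0..e} \<subseteq> M"
      "(\<gamma> has_vector_derivative v) (at 0 within {0..e})"
    unfolding curve_tangents_def by blast
  obtain G where G: "linear G" "G \<circ> T = id"
    using linear_injective_left_inverse[OF has_derivative_linear[OF T(1)] T(2)] by blast
  have "(\<psi> has_derivative G) (at p within M)"
  proof (rule has_derivative_left_inverse_within[where \<phi> = \<phi> and T = T])
    show "(\<phi> has_derivative T) (at (\<psi> p))" by fact
    show "bounded_linear G" "\<And>x. G (T x) = x"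
      using G by (simp_all add: linear_conv_bounded_linear fun_eq_iff)
    show "continuous (at p within M) \<psi>" "\<And>q. q \<in> M \<Longrightarrow> \<phi> (\<psi> q) = q"
      using homeo \<open>p \<in> M\<close> by (auto simp: homeomorphism_def continuous_on_eq_continuous_within)
  qed fact
  then have "(\<psi> has_derivative G) (at (\<gamma> 0) within \<gamma> ` {0..e})"
    using \<gamma>(2,3) has_derivative_subset by blast
  then have "((\<lambda>t. \<psi> (\<gamma> t)) has_derivative (\<lambda>t. G (t *\<^sub>R v))) (at 0 within {0..e})"
    using \<gamma>(4) unfolding has_vector_derivative_def by (rule has_derivative_in_compose[rotated])
  then have "((\<lambda>t. \<phi> (\<psi> (\<gamma> t))) has_derivative (\<lambda>t. T (G (t *\<^sub>R v)))) (at 0 within {0..e})"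
    by (rule has_derivative_compose) (simp add: \<gamma>(2) T(1))
  then have "((\<lambda>t. \<phi> (\<psi> (\<gamma> t))) has_vector_derivative T (G v)) (at 0 within {0..e})"
    unfolding has_vector_derivative_def
    by (simp add: linear_scale[OF G(1)] linear_scale[OF has_derivative_linear[OF T(1)]])
  then have "(\<gamma> has_vector_derivative T (G v)) (at 0 within {0..e})"
    by (rule has_vector_derivative_transform[rotated 2])
      (use \<gamma>(1,3) homeomorphism_apply2[OF homeo] in \<open>auto simp: image_subset_iff\<close>)
  then have "v = T (G v)"
    using vector_derivative_unique_within_closed_interval[of 0 e 0 \<gamma>] \<gamma>(1,4) by simp
  then show "v \<in> range T" by (rule range_eqI)
qed

section \<open>Special Lagrangian submanifolds\<close>

definition SL_tangent_map :: "('a::real_vector \<Rightarrow> complex^3) \<Rightarrow> bool" where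
  "SL_tangent_map T \<longleftrightarrow> inj T \<and> (\<forall>a b. omega_C3 (T a) (T b) = 0) \<and>
     (\<forall>a b c. Im (Omega_C3 (T a) (T b) (T c)) = 0)"

lemma SL_tangent_map_compose: "SL_tangent_map T \<Longrightarrow> inj f \<Longrightarrow> SL_tangent_map (\<lambda>x. T (f x))"
  by (simp add: SL_tangent_map_def inj_def)

definition SL_chart_at ::
  "complex^3 \<Rightarrow> (complex^3) set \<Rightarrow> 'a::euclidean_space set \<Rightarrow> ('a \<Rightarrow> complex^3) \<Rightarrow> (complex^3 \<Rightarrow> 'a) \<Rightarrow> bool"
  where
  "SL_chart_at p L V \<phi> \<psi> \<longleftrightarrow> open V \<and> smooth_on V \<phi> \<and>
     (\<exists>U. open U \<and> p \<in> U \<and> homeomorphism V (L \<inter> U) \<phi> \<psi>) \<and>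
     (\<forall>x\<in>V. SL_tangent_map (frechet_derivative \<phi> (at x)))"

lemma SL_submanifold_iff_SL_chart_at:
  "SL_submanifold L \<longleftrightarrow> (\<forall>p\<in>L. \<exists>(V :: (real^3) set) \<phi> \<psi>. SL_chart_at p L V \<phi> \<psi>)"
  unfolding SL_submanifold_def SL_chart_at_def SL_tangent_map_def by (rule ball_cong) auto

lemma SL_chart_atI:
  assumes "open U" "p \<in> U" "homeomorphism V (L \<inter> U) \<phi> \<psi>" "smooth_on V \<phi>"
    and "\<And>x. x \<in> V \<Longrightarrow> (\<phi> has_derivative T x) (at x)" "\<And>x. x \<in> V \<Longrightarrow> SL_tangent_map (T x)"
  shows "SL_chart_at p L V \<phi> \<psi>"
proof -
  have "SL_tangent_map (frechet_derivative \<phi> (at x))" if "x \<in> V" for x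
    using assms(6)[OF that] frechet_derivative_at[OF assms(5)[OF that]] by simp
  then show ?thesis
    unfolding SL_chart_at_def using assms(1-4) smooth_on_open[OF assms(4)] by blast
qed

lemma SL_chart_atE:
  assumes "SL_chart_at p L V \<phi> \<psi>"
  obtains U T where "open U" "p \<in> U" "homeomorphism V (L \<inter> U) \<phi> \<psi>" "smooth_on V \<phi>"
    "\<forall>x\<in>V. (\<phi> has_derivative T x) (at x)" "\<forall>x\<in>V. SL_tangent_map (T x)"
proof -
  obtain U where U: "open U" "p \<in> U" "homeomorphism V (L \<inter> U) \<phi> \<psi>"
    using assms unfolding SL_chart_at_def by blast
  have \<phi>: "smooth_on V \<phi>" "\<forall>x\<in>V. SL_tangent_map (frechet_derivative \<phi> (at x))"
    using assms by (simp_all add: SL_chart_at_def)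
  have "\<forall>x\<in>V. (\<phi> has_derivative frechet_derivative \<phi> (at x)) (at x)"
    using smooth_on_imp_differentiable_at[OF \<phi>(1)] by (simp add: frechet_derivative_works)
  from that[OF U \<phi>(1) this \<phi>(2)] show thesis .
qed

lemma SL_chart_at_linear_domain:
  fixes f :: "'b::euclidean_space \<Rightarrow> 'a::euclidean_space"
  assumes chart: "SL_chart_at p L V \<phi> \<psi>"
    and "linear f" "linear g" and gf: "\<And>x. g (f x) = x" and fg: "\<And>y. f (g y) = y"
  shows "SL_chart_at p L (f -` V) (\<phi> \<circ> f) (g \<circ> \<psi>)"
proof -
  obtain U T where U: "open U" "p \<in> U" "homeomorphism V (L \<inter> U) \<phi> \<psi>" and \<phi>: "smooth_on V \<phi>"
      and T: "\<forall>x\<in>V. (\<phi> has_derivative T x) (at x)" "\<forall>x\<in>V. SL_tangent_map (T x)"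
    using chart by (rule SL_chart_atE)
  have lin: "bounded_linear f" "bounded_linear g"
    using assms(2,3) by (simp_all add: linear_conv_bounded_linear)
  have "open (f -` V)"
    by (rule open_vimage[OF smooth_on_open[OF \<phi>] linear_continuous_on[OF lin(1)]])
  then have smooth: "smooth_on (f -` V) (\<phi> \<circ> f)"
    unfolding o_def by (intro smooth_on_compose[OF linear_imp_smooth_on[OF assms(2)] \<phi>]) auto
  have "homeomorphism (f -` V) V f g"
    by (intro homeomorphismI linear_continuous_on lin) (auto simp: gf fg)
  then have homeo: "homeomorphism (f -` V) (L \<inter> U) (\<phi> \<circ> f) (g \<circ> \<psi>)"
    using U(3) by (rule homeomorphism_compose)
  show ?thesis
  proof (rule SL_chart_atI[OF U(1,2) homeo smooth])
    fix x assume "x \<in> f -` V"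
    then have x: "f x \<in> V" by simp
    show "((\<phi> \<circ> f) has_derivative (\<lambda>h. T (f x) (f h))) (at x)"
      unfolding o_def
      by (rule has_derivative_compose[OF bounded_linear_imp_has_derivative[OF lin(1)] bspec[OF T(1) x]])
    show "SL_tangent_map (\<lambda>h. T (f x) (f h))"
      by (rule SL_tangent_map_compose[OF bspec[OF T(2) x] inj_on_inverseI[of _ g]]) (rule gf)
  qed
qed

lemma SL_chart_at_linear_image:
  fixes V :: "'a::euclidean_space set"
  assumes chart: "SL_chart_at p L V \<phi> \<psi>"
    and "linear A" "linear B" and BA: "\<And>x. B (A x) = x" and AB: "\<And>y. A (B y) = y"
    and SL: "\<And>T :: 'a \<Rightarrow> complex^3. SL_tangent_map T \<Longrightarrow> SL_tangent_map (\<lambda>x. A (T x))"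
  shows "SL_chart_at (A p) (A ` L) V (A \<circ> \<phi>) (\<psi> \<circ> B)"
proof -
  obtain U T where U: "open U" "p \<in> U" "homeomorphism V (L \<inter> U) \<phi> \<psi>" and \<phi>: "smooth_on V \<phi>"
      and T: "\<forall>x\<in>V. (\<phi> has_derivative T x) (at x)" "\<forall>x\<in>V. SL_tangent_map (T x)"
    using chart by (rule SL_chart_atE)
  have lin: "bounded_linear A" "bounded_linear B"
    using assms(2,3) by (simp_all add: linear_conv_bounded_linear)
  have "homeomorphism (L \<inter> U) (A ` (L \<inter> U)) A B"
    by (intro homeomorphism_left_inverse linear_continuous_on lin BA)
  then have homeo: "homeomorphism V (A ` L \<inter> A ` U) (A \<circ> \<phi>) (\<psi> \<circ> B)"
    using homeomorphism_compose[OF U(3)] image_Int[OF inj_on_inverseI[of _ B A, OF BA]] by simp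
  have "open (A ` U)"
    by (rule open_surjective_linear_image[OF U(1) assms(2) surjI[of A B, OF AB]])
  moreover have "A p \<in> A ` U" using U(2) by blast
  moreover have "smooth_on V (A \<circ> \<phi>)"
    unfolding o_def by (rule smooth_on_linear[OF lin(1) \<phi>])
  ultimately show ?thesis
    using homeo
  proof (intro SL_chart_atI)
    fix x assume "x \<in> V"
    show "((A \<circ> \<phi>) has_derivative (\<lambda>h. A (T x h))) (at x)"
      unfolding o_def by (rule bounded_linear.has_derivative[OF lin(1) bspec[OF T(1) \<open>x \<in> V\<close>]])
    show "SL_tangent_map (\<lambda>h. A (T x h))" by (rule SL[OF bspec[OF T(2) \<open>x \<in> V\<close>]])
  qed
qed

lemma SL_submanifoldI:
  assumes "DIM('a::euclidean_space) = 3"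
    and "\<And>p. p \<in> L \<Longrightarrow> \<exists>(V :: 'a set) \<phi> \<psi>. SL_chart_at p L V \<phi> \<psi>"
  shows "SL_submanifold L"
  unfolding SL_submanifold_iff_SL_chart_at
proof
  fix p assume "p \<in> L"
  obtain f :: "real^3 \<Rightarrow> 'a" and g where f: "linear f" "linear g" "\<And>x. g (f x) = x" "\<And>y. f (g y) = y"
    by (rule isomorphisms_UNIV_UNIV[where 'M = "real^3" and 'N = 'a]) (use assms(1) in auto)
  obtain V \<phi> \<psi> where "SL_chart_at p L (V :: 'a set) \<phi> \<psi>"
    using assms(2)[OF \<open>p \<in> L\<close>] by blast
  from SL_chart_at_linear_domain[OF this f]
  show "\<exists>(V :: (real^3) set) \<phi> \<psi>. SL_chart_at p L V \<phi> \<psi>" by blast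
qed

lemma SL_submanifold_linear_image:
  assumes "SL_submanifold L" "linear A" "linear B" "\<And>x. B (A x) = x" "\<And>y. A (B y) = y"
    and "\<And>T :: real^3 \<Rightarrow> complex^3. SL_tangent_map T \<Longrightarrow> SL_tangent_map (\<lambda>x. A (T x))"
  shows "SL_submanifold (A ` L)"
  unfolding SL_submanifold_iff_SL_chart_at
proof
  fix q assume "q \<in> A ` L"
  then obtain p where p: "p \<in> L" "q = A p" by blast
  then obtain V :: "(real^3) set" and \<phi> \<psi> where "SL_chart_at p L V \<phi> \<psi>"
    using assms(1) unfolding SL_submanifold_iff_SL_chart_at by blast
  from SL_chart_at_linear_image[OF this assms(2-6)]
  show "\<exists>(V :: (real^3) set) \<phi> \<psi>. SL_chart_at q (A ` L) V \<phi> \<psi>"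
    unfolding p(2) by blast
qed

lemma SL_submanifold_curve_tangents_omega:
  assumes "SL_submanifold L" "p \<in> L" "u \<in> curve_tangents L p" "v \<in> curve_tangents L p"
  shows "omega_C3 u v = 0"
proof -
  obtain V :: "(real^3) set" and \<phi> \<psi> where "SL_chart_at p L V \<phi> \<psi>"
    using assms(1,2) unfolding SL_submanifold_iff_SL_chart_at by blast
  then obtain U T where U: "open U" "p \<in> U" "homeomorphism V (L \<inter> U) \<phi> \<psi>" and "smooth_on V \<phi>"
      and T: "\<forall>x\<in>V. (\<phi> has_derivative T x) (at x)" "\<forall>x\<in>V. SL_tangent_map (T x)"
    by (rule SL_chart_atE)
  have "\<psi> p \<in> V"
    using U assms(2) by (auto simp: homeomorphism_def)
  note T = T[THEN bspec, OF this]
  have "curve_tangents (L \<inter> U) p \<subseteq> range (T (\<psi> p))"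
    by (rule curve_tangents_subset_range_immersion[OF U(3) _ T(1)])
      (use U(2) assms(2) T(2) in \<open>simp_all add: SL_tangent_map_def\<close>)
  then have "u \<in> range (T (\<psi> p))" "v \<in> range (T (\<psi> p))"
    using curve_tangents_Int_open[OF U(1,2)] assms(3,4) by blast+
  then show ?thesis
    using T(2) by (auto simp: SL_tangent_map_def)
qed

lemma nonsingular_SL3_imp_singular_SL3:
  assumes "nonsingular_SL3 S"
  shows "singular_SL3 S"
proof -
  have "singular_points S = {}"
    using assms by (auto simp: nonsingular_SL3_def singular_points_def intro!: exI[of _ UNIV])
  then show ?thesis using assms by (simp add: nonsingular_SL3_def singular_SL3_def)
qed

section \<open>The map and its fibres\<close>

lemma F_fib_cases_exclusive:
  fixes z :: "complex^3"
  shows "let a = ((cmod (z$1))\<^sup>2 - (cmod (z$2))\<^sup>2) / 2 in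
    length (filter id [a = 0 \<and> z$1 = 0 \<and> z$2 = 0, a \<ge> 0 \<and> z$1 \<noteq> 0, a < 0]) = 1"
proof -
  have "(cmod (z$1))\<^sup>2 < (cmod (z$2))\<^sup>2 \<longleftrightarrow> cmod (z$1) < cmod (z$2)"
    by (metis abs_le_square_iff abs_norm_cancel not_le)
  then show ?thesis by (auto simp: Let_def)
qed

lemma F_fib_eq:
  "F_fib z = (((cmod (z$1))\<^sup>2 - (cmod (z$2))\<^sup>2) / 2,
     z$3 - cnj (z$1 * z$2) / complex_of_real (max (cmod (z$1)) (cmod (z$2))))"
proof -
  have "(cmod (z$1))\<^sup>2 - (cmod (z$2))\<^sup>2 \<ge> 0 \<longleftrightarrow> cmod (z$2) \<le> cmod (z$1)"
    by (simp add: abs_le_square_iff[symmetric])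
  then show ?thesis
    by (auto simp: F_fib_def Let_def max_def)
qed

lemma eq_cnj_divide_iff:
  assumes "m \<ge> 0"
  shows "w = cnj P / complex_of_real m \<longleftrightarrow> cmod w = cmod P / m \<and> Im (P * w) = 0 \<and> Re (P * w) \<ge> 0"
proof
  assume w: "w = cnj P / complex_of_real m"
  then have "P * w = complex_of_real ((cmod P)\<^sup>2 / m)"
    using complex_norm_square[of P] by simp
  then show "cmod w = cmod P / m \<and> Im (P * w) = 0 \<and> Re (P * w) \<ge> 0"
    using w assms by (auto simp: norm_divide)
next
  assume w: "cmod w = cmod P / m \<and> Im (P * w) = 0 \<and> Re (P * w) \<ge> 0"
  show "w = cnj P / complex_of_real m"
  proof (cases "P = 0")
    case False
    have "P * w = complex_of_real (cmod (P * w))"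
      using w by (intro complex_eqI) (auto simp: cmod_eq_Re simp del: times_complex.sel)
    also have "\<dots> = complex_of_real ((cmod P)\<^sup>2) / complex_of_real m"
      using w by (simp add: norm_mult power2_eq_square)
    also have "\<dots> = P * (cnj P / complex_of_real m)"
      by (simp add: complex_norm_square del: of_real_power)
    finally show ?thesis unfolding mult_left_cancel[OF False] .
  qed (use w in auto)
qed

lemma F_fib_eq_iff: "F_fib z = (a, c) \<longleftrightarrow> z \<in> N_ac a c"
proof -
  define m n where "m = max (cmod (z$1)) (cmod (z$2))" and "n = min (cmod (z$1)) (cmod (z$2))"
  have "m \<ge> 0" "n \<ge> 0" "cmod (z$1 * z$2) / m = n"
    by (auto simp: m_def n_def norm_mult max_def min_def)
  then have quotient: "z$3 - c = cnj (z$1 * z$2) / complex_of_real m \<longleftrightarrow>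
      (cmod (z$3 - c))\<^sup>2 = n\<^sup>2 \<and> Im (z$1 * z$2 * (z$3 - c)) = 0 \<and> Re (z$1 * z$2 * (z$3 - c)) \<ge> 0"
    using eq_cnj_divide_iff[of m "z$3 - c" "z$1 * z$2"] by (simp add: power2_eq_iff_nonneg)
  have "n\<^sup>2 = min ((cmod (z$1))\<^sup>2) ((cmod (z$2))\<^sup>2)"
    by (simp add: n_def min_def abs_le_square_iff[symmetric])
  then have third_norm: "(cmod (z$3 - c))\<^sup>2 = n\<^sup>2 \<longleftrightarrow> (cmod (z$2))\<^sup>2 + a = (cmod (z$3 - c))\<^sup>2 + \<bar>a\<bar>"
    if "(cmod (z$1))\<^sup>2 - a = (cmod (z$2))\<^sup>2 + a"
    using that unfolding min_def abs_if by (smt (verit))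
  have "F_fib z = (a, c) \<longleftrightarrow> (cmod (z$1))\<^sup>2 - a = (cmod (z$2))\<^sup>2 + a \<and>
      z$3 - c = cnj (z$1 * z$2) / complex_of_real m"
    by (auto simp: F_fib_eq m_def field_simps)
  also have "\<dots> \<longleftrightarrow> z \<in> N_ac a c"
    unfolding quotient N_ac_def mem_Collect_eq using third_norm by blast
  finally show ?thesis .
qed

lemma N_ac_nonneg_iff:
  assumes "a \<ge> 0"
  shows "z \<in> N_ac a c \<longleftrightarrow> (cmod (z$1))\<^sup>2 = (cmod (z$2))\<^sup>2 + 2 * a \<and> z$3 = c + cnj (sgn (z$1) * z$2)"
proof -
  have "max (cmod (z$1)) (cmod (z$2)) = cmod (z$1)" if "(cmod (z$1))\<^sup>2 = (cmod (z$2))\<^sup>2 + 2 * a"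
  proof -
    have "(cmod (z$2))\<^sup>2 \<le> (cmod (z$1))\<^sup>2" using that assms by simp
    then show ?thesis by (simp add: max_def power2_le_iff_abs_le)
  qed
  then show ?thesis
    unfolding F_fib_eq_iff[symmetric] F_fib_eq by (auto simp: sgn_eq field_simps)
qed

lemma continuous_F_fib: "continuous_on UNIV F_fib"
proof -
  let ?m = "\<lambda>z::complex^3. max (cmod (z$1)) (cmod (z$2))"
  let ?q = "\<lambda>z::complex^3. cnj (z$1 * z$2) / complex_of_real (?m z)"
  have "isCont ?q z" for z
  proof (cases "?m z = 0")
    case False
    then show ?thesis
      by (intro continuous_intros) auto
  next
    case True
    then have z: "z$1 = 0" by (auto simp: max_def split: if_splits)
    have "norm (?q y) \<le> norm (y$1)" for y
      by (cases "?m y = 0") (auto simp: norm_mult norm_divide field_simps intro!: mult_left_mono)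
    then have bound: "\<forall>\<^sub>F y in at z. norm (?q y) \<le> norm (y$1)"
      by (rule always_eventually[OF allI])
    have "((\<lambda>y::complex^3. y$1) \<longlongrightarrow> 0) (at z)"
      by (intro tendsto_eq_intros) (auto simp: z)
    then have "(?q \<longlongrightarrow> 0) (at z)"
      by (rule Lim_null_comparison[OF bound tendsto_norm_zero])
    then show ?thesis using z by (simp add: isCont_def)
  qed
  then have q: "continuous_on UNIV ?q" by (simp add: continuous_at_imp_continuous_on)
  show ?thesis
    unfolding F_fib_eq[abs_def]
    by (intro continuous_on_Pair continuous_on_diff[OF _ q]) (intro continuous_intros; simp)+
qed

lemma vimage_F_fib: "F_fib -` {(a, c)} = N_ac a c"
  by (auto simp: F_fib_eq_iff)

lemma closed_N_ac: "closed (N_ac a c)"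
  unfolding vimage_F_fib[symmetric] by (rule closed_vimage[OF closed_singleton continuous_F_fib])

lemma surj_F_fib: "surj F_fib"
proof -
  have "\<exists>z. F_fib z = (a, c)" for a c
  proof (cases "a \<ge> 0")
    case True
    then show ?thesis
      by (intro exI[of _ "vector [complex_of_real (sqrt (2 * a)), 0, c]"]) (simp add: F_fib_eq)
  next
    case False
    then show ?thesis
      by (intro exI[of _ "vector [0, complex_of_real (sqrt (- 2 * a)), c]"]) (simp add: F_fib_eq)
  qed
  then show ?thesis by (metis surj_def surj_pair)
qed

lemma F_fib_piecewise_smooth:
  "\<exists>g1 g2 :: complex^3 \<Rightarrow> real \<times> complex.
     smooth_on {z. z$1 \<noteq> 0} g1 \<and> smooth_on {z. z$2 \<noteq> 0} g2 \<and>
     (\<forall>z. cmod (z$1) \<ge> cmod (z$2) \<and> z$1 \<noteq> 0 \<longrightarrow> F_fib z = g1 z) \<and>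
     (\<forall>z. cmod (z$1) \<le> cmod (z$2) \<and> z$2 \<noteq> 0 \<longrightarrow> F_fib z = g2 z)"
proof -
  let ?g = "\<lambda>i. \<lambda>z::complex^3. (((cmod (z$1))\<^sup>2 - (cmod (z$2))\<^sup>2) / 2,
    z$3 - cnj (z$1 * z$2) / complex_of_real (cmod (z$i)))"
  have "open {z::complex^3. z$i \<noteq> 0}" for i
    by (intro open_Collect_neq continuous_intros)
  then have "smooth_on {z. z$i \<noteq> 0} (?g i)" for i
    by (intro smooth_on_intros) auto
  then show ?thesis
    by (intro exI[of _ "?g 1"] exI[of _ "?g 2"]) (auto simp: F_fib_eq max_def)
qed

lemma abs_not_differentiable_at_0: "\<not> (abs :: real \<Rightarrow> real) differentiable at 0"
proof
  assume "(abs :: real \<Rightarrow> real) differentiable at 0"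
  then obtain D where D: "((\<lambda>t::real. \<bar>t\<bar>) has_vector_derivative D) (at 0)"
    using vector_derivative_works by blast
  have "((\<lambda>t. t) has_vector_derivative D) (at (0::real) within cbox 0 1)"
    by (rule has_vector_derivative_transform[OF _ _ has_vector_derivative_at_within[OF D]]) auto
  then have "D = 1"
    using vector_derivative_unique_within_closed_interval[of 0 1 0 "\<lambda>t. t" D 1]
    by (auto intro: derivative_intros)
  have "((\<lambda>t. - t) has_vector_derivative D) (at (0::real) within cbox (-1) 0)"
    by (rule has_vector_derivative_transform[OF _ _ has_vector_derivative_at_within[OF D]]) auto
  then have "D = - 1"
    by (rule vector_derivative_unique_within_closed_interval[of "-1" 0 0, rotated 2])
      (auto intro!: derivative_eq_intros)
  with \<open>D = 1\<close> show False by simp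
qed

lemma snd_F_fib_scale_first:
  assumes "cmod (z$1) = cmod (z$2)" "t > -1"
  shows "snd (F_fib (z + t *\<^sub>R axis 1 (z$1))) =
    z$3 - complex_of_real (1 + min t 0) * (cnj (z$1 * z$2) / complex_of_real (cmod (z$1)))"
proof -
  define y where "y = z + t *\<^sub>R axis 1 (z$1)"
  have y: "y $ 1 = complex_of_real (1 + t) * z$1" "y $ 2 = z$2" "y $ 3 = z$3"
    by (simp_all add: y_def axis_def scaleR_conv_of_real[of _ "z$1"] algebra_simps)
  have "cmod (y $ 1) = (1 + t) * cmod (z$1)"
    unfolding y norm_mult norm_of_real using assms(2) by simp
  then have "max (cmod (y $ 1)) (cmod (y $ 2)) = max (1 + t) 1 * cmod (z$1)"
    using assms(1) by (simp add: y(2) max_mult_distrib_right)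
  moreover have "cnj (y $ 1 * y $ 2) / complex_of_real (max (1 + t) 1 * cmod (z$1)) =
      complex_of_real ((1 + t) / max (1 + t) 1) * (cnj (z$1 * z$2) / complex_of_real (cmod (z$1)))"
    by (simp add: y(1,2) mult_ac)
  moreover have "(1 + t) / max (1 + t) 1 = 1 + min t 0"
    using assms(2) by (auto simp: max_def min_def)
  ultimately show ?thesis
    unfolding y_def[symmetric] by (simp only: F_fib_eq snd_conv y(3))
qed

lemma F_fib_not_differentiable:
  assumes "cmod (z$1) = cmod (z$2)" "z$1 \<noteq> 0"
  shows "\<not> F_fib differentiable at z"
proof
  assume F: "F_fib differentiable at z"
  define \<gamma> where "\<gamma> = (\<lambda>t::real. z + t *\<^sub>R axis 1 (z$1))"
  define K where "K = cnj (z$1 * z$2) / complex_of_real (cmod (z$1))"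
  have "K \<noteq> 0" using assms by (auto simp: K_def)
  have "\<gamma> differentiable at 0"
    unfolding \<gamma>_def by (intro derivative_intros)
  then have "(\<lambda>t. F_fib (\<gamma> t)) differentiable at 0"
    using differentiable_compose[of F_fib \<gamma> 0 UNIV] F by (simp add: \<gamma>_def)
  moreover have "bounded_linear (\<lambda>y::real \<times> complex. Re (snd y / K))"
    by (intro bounded_linear_compose[OF bounded_linear_Re]
        bounded_linear_compose[OF bounded_linear_divide] bounded_linear_snd)
  ultimately have "(\<lambda>t. Re (snd (F_fib (\<gamma> t)) / K)) differentiable at 0"
    using differentiable_compose[of "\<lambda>y. Re (snd y / K)" "\<lambda>t. F_fib (\<gamma> t)" 0 UNIV]
    by (simp add: bounded_linear_imp_differentiable)
  then have diff: "(\<lambda>t. t + 2 * (Re (snd (F_fib (\<gamma> t)) / K) - Re (z$3 / K) + 1)) differentiable at 0"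
    by (intro differentiable_add differentiable_mult differentiable_diff
        differentiable_ident differentiable_const)
  have "t + 2 * (Re (snd (F_fib (\<gamma> t)) / K) - Re (z$3 / K) + 1) = \<bar>t\<bar>" if "t > -1" for t
    using \<open>K \<noteq> 0\<close>
    unfolding \<gamma>_def snd_F_fib_scale_first[OF assms(1) that] K_def[symmetric] diff_divide_distrib
    by simp
  then have "abs differentiable at (0::real)"
    by (intro differentiable_transform_within[OF diff zero_less_one]) (auto simp: dist_real_def)
  then show False using abs_not_differentiable_at_0 by simp
qed

lemma F_fib_not_smooth_at:
  assumes "cmod (z$1) = cmod (z$2)"
  shows "\<not> smooth_at F_fib z"
proof
  assume "smooth_at F_fib z"
  then obtain U where U: "open U" "z \<in> U" "smooth_on U F_fib" unfolding smooth_at_def by blast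
  have "\<exists>y\<in>U. cmod (y$1) = cmod (y$2) \<and> y$1 \<noteq> 0"
  proof (cases "z$1 = 0")
    case True
    let ?y = "\<lambda>t. z + t *\<^sub>R vector [1, 1, 0]"
    have "(?y \<longlongrightarrow> z) (at_right 0)"
      by (auto intro!: tendsto_eq_intros)
    then have "\<forall>\<^sub>F t in at_right 0. ?y t \<in> U"
      using U by (intro topological_tendstoD)
    then have "\<forall>\<^sub>F t in at_right 0. ?y t \<in> U \<and> t > 0"
      by (intro eventually_conj eventually_at_right_less)
    then obtain t where "?y t \<in> U" "t > 0"
      using eventually_happens trivial_limit_at_right_real by blast
    moreover have "z$2 = 0" using assms True by simp
    ultimately show ?thesis using True by (intro bexI[of _ "?y t"]) auto
  qed (use U(2) assms in auto)
  then obtain y where "y \<in> U" "cmod (y$1) = cmod (y$2)" "y$1 \<noteq> 0" by blast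
  then show False
    using F_fib_not_differentiable smooth_on_imp_differentiable_at[OF U(3)] by blast
qed

section \<open>Parametrisation of the fibres\<close>

definition N_param :: "real \<Rightarrow> complex \<Rightarrow> complex \<times> complex \<Rightarrow> complex^3" where
  "N_param a c x = vector [fst x * complex_of_real (sqrt ((cmod (snd x))\<^sup>2 + 2 * a)), snd x,
     c + cnj (fst x * snd x)]"

definition N_coords :: "complex^3 \<Rightarrow> complex \<times> complex" where
  "N_coords z = (sgn (z$1), z$2)"

definition N_domain :: "real \<Rightarrow> (complex \<times> complex) set" where
  "N_domain a = sphere 0 1 \<times> {u. (cmod u)\<^sup>2 + 2 * a > 0}"

lemma N_coords_N_param:
  assumes "x \<in> N_domain a"
  shows "N_coords (N_param a c x) = x"
proof -
  have "sgn (fst x) = fst x" using assms by (auto simp: N_domain_def sgn_eq)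
  then show ?thesis
    using assms by (auto simp: N_domain_def N_coords_def N_param_def sgn_mult sgn_of_real)
qed

lemma N_param_in_N_ac:
  assumes "a \<ge> 0" "x \<in> N_domain a"
  shows "N_param a c x \<in> N_ac a c \<inter> {z. z$1 \<noteq> 0}"
proof -
  have "sgn (N_param a c x $ 1) = fst x"
    using N_coords_N_param[OF assms(2), of c] by (simp add: N_coords_def prod_eq_iff)
  moreover have "cmod (N_param a c x $ 1) = sqrt ((cmod (snd x))\<^sup>2 + 2 * a)"
    using assms(2) by (auto simp: N_domain_def N_param_def norm_mult)
  ultimately show ?thesis
    using assms(2) by (auto simp: N_domain_def N_ac_nonneg_iff[OF assms(1)] N_param_def)
qed

lemma N_coords_inverse:
  assumes "a \<ge> 0" "z \<in> N_ac a c \<inter> {z. z$1 \<noteq> 0}"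
  shows "N_coords z \<in> N_domain a" "N_param a c (N_coords z) = z"
proof -
  have z: "(cmod (z$1))\<^sup>2 = (cmod (z$2))\<^sup>2 + 2 * a" "z$3 = c + cnj (sgn (z$1) * z$2)" "z$1 \<noteq> 0"
    using assms N_ac_nonneg_iff[OF assms(1)] by auto
  then show "N_coords z \<in> N_domain a"
    by (simp add: N_domain_def N_coords_def norm_sgn flip: z(1))
  show "N_param a c (N_coords z) = z"
    using z by (simp add: N_param_def N_coords_def vec_eq_iff forall_3 sgn_eq flip: z(1))
qed

lemma open_first_nonzero: "open {z::complex^3. z$1 \<noteq> 0}"
  by (intro open_Collect_neq continuous_intros)

lemma smooth_on_N_coords: "smooth_on {z. z$1 \<noteq> 0} N_coords"
  unfolding N_coords_def[abs_def] by (intro smooth_on_intros open_first_nonzero) auto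

lemma smooth_on_N_param:
  assumes "smooth_on U f" "\<And>x. x \<in> U \<Longrightarrow> (cmod (snd (f x)))\<^sup>2 + 2 * a > 0"
  shows "smooth_on U (\<lambda>x. N_param a c (f x))"
  unfolding N_param_def by (intro smooth_on_intros smooth_on_open[OF assms(1)] assms)

lemma smooth_map_on_N_param: "smooth_map_on (N_domain a) (N_param a c)"
proof (rule smooth_on_imp_smooth_map_on)
  let ?U = "{x :: complex \<times> complex. (cmod (snd x))\<^sup>2 + 2 * a > 0}"
  have "open ?U"
    by (intro open_Collect_less continuous_intros)
  from smooth_on_N_param[OF smooth_on_ident[OF this]]
  show "smooth_on ?U (N_param a c)" by simp
qed (auto simp: N_domain_def)

lemma homeomorphism_N_param:
  assumes "a \<ge> 0"
  shows "homeomorphism (N_domain a) (N_ac a c \<inter> {z. z$1 \<noteq> 0}) (N_param a c) N_coords"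
proof (rule homeomorphismI)
  show "continuous_on (N_ac a c \<inter> {z. z$1 \<noteq> 0}) N_coords"
    by (rule continuous_on_subset[OF smooth_on_imp_continuous_on[OF smooth_on_N_coords]]) simp
  show "N_param a c ` N_domain a \<subseteq> N_ac a c \<inter> {z. z$1 \<noteq> 0}"
    using N_param_in_N_ac[OF assms] by (rule image_subsetI)
  show "N_coords ` (N_ac a c \<inter> {z. z$1 \<noteq> 0}) \<subseteq> N_domain a"
    using N_coords_inverse(1)[OF assms] by (rule image_subsetI)
qed (simp_all only: smooth_map_on_imp_continuous_on[OF smooth_map_on_N_param] N_coords_N_param
    N_coords_inverse(2)[OF assms])

lemma diffeomorphic_N_param_image:
  assumes "a \<ge> 0" "S \<subseteq> N_domain a"
  shows "diffeomorphic S (N_param a c ` S)"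
proof (rule diffeomorphic_smooth_image)
  show "smooth_map_on S (N_param a c)"
    using smooth_map_on_subset[OF smooth_map_on_N_param assms(2)] .
  show "smooth_map_on (N_param a c ` S) N_coords"
    by (rule smooth_on_imp_smooth_map_on[OF smooth_on_N_coords])
      (use N_param_in_N_ac[OF assms(1)] assms(2) in blast)
  show "N_coords (N_param a c x) = x" if "x \<in> S" for x
    using N_coords_N_param[OF subsetD[OF assms(2) that]] .
qed

section \<open>Special Lagrangian charts of the fibres\<close>

lemma divide_cis_not_nonpos_Real:
  assumes "e \<in> sphere 0 1 - {- cis \<theta>}"
  shows "e / cis \<theta> \<notin> \<real>\<^sub>\<le>\<^sub>0"
proof
  assume "e / cis \<theta> \<in> \<real>\<^sub>\<le>\<^sub>0"
  then obtain r where r: "e / cis \<theta> = complex_of_real r" "r \<le> 0"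
    by (auto elim: nonpos_Reals_cases)
  moreover have "cmod (e / cis \<theta>) = 1" using assms by (simp add: norm_divide)
  ultimately have "r = -1" by simp
  then show False using r(1) assms by (simp add: field_simps)
qed

lemma homeomorphism_cis:
  "homeomorphism {\<theta> - pi<..<\<theta> + pi} (sphere 0 1 - {- cis \<theta>}) cis (\<lambda>e. \<theta> + Arg (e / cis \<theta>))"
proof (rule homeomorphismI)
  show "continuous_on {\<theta> - pi<..<\<theta> + pi} cis"
    by (intro continuous_intros)
  show "continuous_on (sphere 0 1 - {- cis \<theta>}) (\<lambda>e. \<theta> + Arg (e / cis \<theta>))"
    by (intro continuous_intros divide_cis_not_nonpos_Real) simp_all
  show left: "\<theta> + Arg (cis s / cis \<theta>) = s" if "s \<in> {\<theta> - pi<..<\<theta> + pi}" for s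
    using Arg_cis[of "s - \<theta>"] that by (simp add: cis_divide)
  show "cis ` {\<theta> - pi<..<\<theta> + pi} \<subseteq> sphere 0 1 - {- cis \<theta>}"
  proof (rule image_subsetI)
    fix s assume s: "s \<in> {\<theta> - pi<..<\<theta> + pi}"
    have "cis s \<noteq> - cis \<theta>"
    proof
      assume "cis s = - cis \<theta>"
      then have "cis s / cis \<theta> = - 1" by simp
      then have "\<theta> + pi = s" using left[OF s] Arg_of_real[of "-1"] by simp
      then show False using s by simp
    qed
    then show "cis s \<in> sphere 0 1 - {- cis \<theta>}" by simp
  qed
  fix e assume e: "e \<in> sphere 0 1 - {- cis \<theta>}"
  have "cis (Arg (e / cis \<theta>)) = e / cis \<theta>"
    using e by (subst cis_Arg) (auto simp: sgn_eq norm_divide)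
  then show "cis (\<theta> + Arg (e / cis \<theta>)) = e" by (simp flip: cis_mult)
next
  show "(\<lambda>e. \<theta> + Arg (e / cis \<theta>)) ` (sphere 0 1 - {- cis \<theta>}) \<subseteq> {\<theta> - pi<..<\<theta> + pi}"
  proof (rule image_subsetI)
    fix e assume e: "e \<in> sphere 0 1 - {- cis \<theta>}"
    have "Arg (e / cis \<theta>) \<noteq> pi"
      using divide_cis_not_nonpos_Real[OF e] by (auto simp: Arg_eq_pi complex_nonpos_Reals_iff)
    then show "\<theta> + Arg (e / cis \<theta>) \<in> {\<theta> - pi<..<\<theta> + pi}"
      using Arg_bounded[of "e / cis \<theta>"] by auto
  qed
qed

definition N_chart :: "real \<Rightarrow> complex \<Rightarrow> real \<times> complex \<Rightarrow> complex^3" where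
  "N_chart a c x = N_param a c (cis (fst x), snd x)"

lemma homeomorphism_N_chart:
  assumes "a \<ge> 0"
  shows "homeomorphism ({\<theta> - pi<..<\<theta> + pi} \<times> {u. (cmod u)\<^sup>2 + 2 * a > 0})
    (N_ac a c \<inter> {z. z$1 \<noteq> 0} \<inter> N_coords -` ((- {- cis \<theta>}) \<times> UNIV))
    (N_chart a c) (map_prod (\<lambda>e. \<theta> + Arg (e / cis \<theta>)) id \<circ> N_coords)"
proof -
  let ?I = "{\<theta> - pi<..<\<theta> + pi}" and ?D = "{u. (cmod u)\<^sup>2 + 2 * a > 0}"
  have angle: "homeomorphism (?I \<times> ?D) ((sphere 0 1 - {- cis \<theta>}) \<times> ?D) (map_prod cis id)
      (map_prod (\<lambda>e. \<theta> + Arg (e / cis \<theta>)) id)"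
    by (intro homeomorphism_map_prod homeomorphism_cis homeomorphism_ident[folded id_def])
  have "(sphere 0 1 - {- cis \<theta>}) \<times> ?D = N_domain a \<inter> (- {- cis \<theta>}) \<times> UNIV"
    by (auto simp: N_domain_def)
  then have param: "homeomorphism ((sphere 0 1 - {- cis \<theta>}) \<times> ?D)
      (N_ac a c \<inter> {z. z$1 \<noteq> 0} \<inter> N_coords -` ((- {- cis \<theta>}) \<times> UNIV)) (N_param a c) N_coords"
    using homeomorphism_Int_vimage[OF homeomorphism_N_param[OF assms]] by simp
  have "N_param a c \<circ> map_prod cis id = N_chart a c"
    by (simp add: fun_eq_iff N_chart_def)
  with homeomorphism_compose[OF angle param] show ?thesis by simp
qed

definition N_chart_deriv :: "real \<Rightarrow> real \<times> complex \<Rightarrow> real \<times> complex \<Rightarrow> complex^3" where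
  "N_chart_deriv a x h =
    (let e = cis (fst x); u = snd x; R = sqrt ((cmod u)\<^sup>2 + 2 * a) in
      vector [e * Complex ((u \<bullet> snd h) / R) (fst h * R), snd h, cnj (e * (snd h + \<i> * fst h * u))])"

lemma has_derivative_N_chart:
  assumes "(cmod (snd x))\<^sup>2 + 2 * a > 0"
  shows "(N_chart a c has_derivative N_chart_deriv a x) (at x)"
proof -
  let ?R = "\<lambda>x::real \<times> complex. sqrt ((cmod (snd x))\<^sup>2 + 2 * a)"
  have "(?R has_derivative (\<lambda>h. (snd x \<bullet> snd h) / ?R x)) (at x)"
    using assms unfolding power2_norm_eq_inner
    by (auto intro!: derivative_eq_intros simp: inner_commute field_simps)
  then have R: "((\<lambda>x. complex_of_real (?R x)) has_derivative
      (\<lambda>h. complex_of_real ((snd x \<bullet> snd h) / ?R x))) (at x)"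
    by (rule has_derivative_of_real)
  have snd: "(snd has_derivative snd) (at x)"
    by (rule has_derivative_snd[OF has_derivative_ident])
  have cis: "((\<lambda>x::real \<times> complex. cis (fst x)) has_derivative (\<lambda>h. fst h *\<^sub>R (\<i> * cis (fst x)))) (at x)"
    by (auto intro!: derivative_eq_intros)
  have "(N_chart a c has_derivative (\<lambda>h. vector
      [cis (fst x) * complex_of_real ((snd x \<bullet> snd h) / ?R x) +
         fst h *\<^sub>R (\<i> * cis (fst x)) * complex_of_real (?R x),
       snd h, 0 + cnj (cis (fst x) * snd h + fst h *\<^sub>R (\<i> * cis (fst x)) * snd x)])) (at x)"
    unfolding N_chart_def[abs_def] N_param_def fst_conv snd_conv
    by (intro has_derivative_vector_3 has_derivative_add has_derivative_const has_derivative_cnj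
        has_derivative_mult cis R snd)
  then show ?thesis
    by (rule has_derivative_eq_rhs)
      (simp add: fun_eq_iff N_chart_deriv_def Let_def vec_eq_iff forall_3 complex_eq_iff algebra_simps)
qed

lemma inj_N_chart_deriv:
  assumes "(cmod (snd x))\<^sup>2 + 2 * a > 0"
  shows "inj (N_chart_deriv a x)"
proof (rule injI)
  fix h k assume eq: "N_chart_deriv a x h = N_chart_deriv a x k"
  show "h = k"
    using arg_cong[OF eq, of "\<lambda>v. v$1"] arg_cong[OF eq, of "\<lambda>v. v$2"] assms
    by (simp add: N_chart_deriv_def Let_def prod_eq_iff)
qed

lemma N_chart_deriv_omega_C3:
  assumes "(cmod (snd x))\<^sup>2 + 2 * a > 0"
  shows "omega_C3 (N_chart_deriv a x h) (N_chart_deriv a x k) = 0"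
proof -
  obtain s u where x: "x = (s, u)" by (cases x)
  obtain p v where h: "h = (p, v)" by (cases h)
  obtain q w where k: "k = (q, w)" by (cases k)
  define R where "R = sqrt ((cmod u)\<^sup>2 + 2 * a)"
  have "R \<noteq> 0" using assms by (simp add: R_def x)
  have "cnj (cis s) * cis s = 1" by (simp add: cis_cnj cis_mult)
  then have unit: "cnj (cis s * z) * (cis s * z') = cnj z * z'"
      "cnj (cnj (cis s * z)) * cnj (cis s * z') = z * cnj z'" for z z'
    by (simp_all add: algebra_simps)
  have "omega_C3 (N_chart_deriv a x h) (N_chart_deriv a x k) =
      Im (cnj (Complex ((u \<bullet> v) / R) (p * R)) * Complex ((u \<bullet> w) / R) (q * R)) + Im (cnj v * w)
      + Im ((v + \<i> * p * u) * cnj (w + \<i> * q * u))"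
    unfolding omega_C3_def N_chart_deriv_def Let_def sum_3 vector_3 x h k
      fst_conv snd_conv R_def[symmetric] unit
    by simp
  also have "\<dots> = (u \<bullet> v) * q - p * (u \<bullet> w) + Im (cnj v * w) + Im ((v + \<i> * p * u) * cnj (w + \<i> * q * u))"
    using \<open>R \<noteq> 0\<close> by simp
  also have "\<dots> = 0"
    by (simp add: inner_complex_def algebra_simps)
  finally show ?thesis .
qed

lemma Omega_C3_expand:
  "Omega_C3 u v w = u$1 * v$2 * w$3 + u$2 * v$3 * w$1 + u$3 * v$1 * w$2
     - u$1 * v$3 * w$2 - u$2 * v$1 * w$3 - u$3 * v$2 * w$1"
  by (simp add: Omega_C3_def det_3)

lemma N_chart_deriv_Omega_C3:
  assumes "(cmod (snd x))\<^sup>2 + 2 * a > 0"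
  shows "Im (Omega_C3 (N_chart_deriv a x h) (N_chart_deriv a x k) (N_chart_deriv a x l)) = 0"
proof -
  define e u where "e = cis (fst x)" and "u = snd x"
  define R where "R = sqrt ((cmod u)\<^sup>2 + 2 * a)"
  define M :: "real \<times> complex \<Rightarrow> complex^3"
    where "M h = vector [Complex ((u \<bullet> snd h) * inverse R) (fst h * R), snd h,
      cnj (snd h + \<i> * fst h * u)]" for h
  have "e * cnj e = 1" by (simp add: e_def cis_cnj cis_mult)
  have nth: "N_chart_deriv a x h $ 1 = e * M h $ 1" "N_chart_deriv a x h $ 2 = M h $ 2"
      "N_chart_deriv a x h $ 3 = cnj e * M h $ 3" for h
    by (simp_all add: N_chart_deriv_def M_def Let_def e_def u_def R_def divide_inverse)
  have "Omega_C3 (N_chart_deriv a x h) (N_chart_deriv a x k) (N_chart_deriv a x l) =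
      Omega_C3 (M h) (M k) (M l)"
    unfolding Omega_C3_expand nth using \<open>e * cnj e = 1\<close> by algebra
  also have "Im \<dots> = 0"
    unfolding Omega_C3_expand M_def vector_3 by (simp add: inner_complex_def algebra_simps)
  finally show ?thesis .
qed

lemma SL_tangent_map_N_chart_deriv:
  "(cmod (snd x))\<^sup>2 + 2 * a > 0 \<Longrightarrow> SL_tangent_map (N_chart_deriv a x)"
  by (simp add: SL_tangent_map_def inj_N_chart_deriv N_chart_deriv_omega_C3 N_chart_deriv_Omega_C3)

lemma SL_submanifold_N_ac_first_nonzero:
  assumes "a \<ge> 0"
  shows "SL_submanifold (N_ac a c \<inter> {z. z$1 \<noteq> 0})"
proof (rule SL_submanifoldI[where 'a = "real \<times> complex"])
  fix p assume p: "p \<in> N_ac a c \<inter> {z. z$1 \<noteq> 0}"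
  define \<theta> where "\<theta> = Arg (p$1)"
  define V where "V = {\<theta> - pi<..<\<theta> + pi} \<times> {u. (cmod u)\<^sup>2 + 2 * a > 0}"
  define U where "U = {z. z$1 \<noteq> 0} \<inter> N_coords -` ((- {- cis \<theta>}) \<times> UNIV)"
  have "SL_chart_at p (N_ac a c \<inter> {z. z$1 \<noteq> 0}) V (N_chart a c)
      (map_prod (\<lambda>e. \<theta> + Arg (e / cis \<theta>)) id \<circ> N_coords)"
  proof (rule SL_chart_atI)
    show "open U"
      unfolding U_def
      by (intro continuous_open_preimage[OF smooth_on_imp_continuous_on[OF smooth_on_N_coords]
            open_first_nonzero] open_Times open_Compl closed_singleton open_UNIV)
    have "sgn (p$1) = cis \<theta>" using p by (simp add: \<theta>_def cis_Arg)
    then show "p \<in> U" using p by (auto simp: U_def N_coords_def)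
    have "N_ac a c \<inter> {z. z$1 \<noteq> 0} \<inter> U = N_ac a c \<inter> {z. z$1 \<noteq> 0} \<inter> N_coords -` ((- {- cis \<theta>}) \<times> UNIV)"
      by (auto simp: U_def)
    then show "homeomorphism V (N_ac a c \<inter> {z. z$1 \<noteq> 0} \<inter> U) (N_chart a c)
        (map_prod (\<lambda>e. \<theta> + Arg (e / cis \<theta>)) id \<circ> N_coords)"
      using homeomorphism_N_chart[OF assms] by (simp add: V_def)
    have "open V"
      unfolding V_def by (intro open_Times open_greaterThanLessThan open_Collect_less continuous_intros)
    then show "smooth_on V (N_chart a c)"
      unfolding N_chart_def[abs_def] by (intro smooth_on_N_param smooth_on_intros) (auto simp: V_def)
    fix x assume "x \<in> V"
    then have "(cmod (snd x))\<^sup>2 + 2 * a > 0" by (auto simp: V_def)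
    then show "(N_chart a c has_derivative N_chart_deriv a x) (at x)"
        "SL_tangent_map (N_chart_deriv a x)"
      by (rule has_derivative_N_chart SL_tangent_map_N_chart_deriv)+
  qed
  then show "\<exists>(V :: (real \<times> complex) set) \<phi> \<psi>. SL_chart_at p (N_ac a c \<inter> {z. z$1 \<noteq> 0}) V \<phi> \<psi>"
    by blast
qed simp

section \<open>The nonsingular fibres\<close>

definition swap12 :: "complex^3 \<Rightarrow> complex^3" where
  "swap12 z = vector [z$2, z$1, z$3]"

lemma swap12_nth [simp]: "swap12 z $ 1 = z$2" "swap12 z $ 2 = z$1" "swap12 z $ 3 = z$3"
  by (auto simp: swap12_def)

lemma swap12_swap12 [simp]: "swap12 (swap12 z) = z"
  by (simp add: vec_eq_iff forall_3)

lemma linear_swap12: "linear swap12"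
  by (rule linearI) (simp_all add: vec_eq_iff forall_3)

lemma inj_swap12: "inj swap12"
  by (metis injI swap12_swap12)

lemma N_ac_uminus: "N_ac (- a) c = swap12 ` N_ac a c"
proof -
  have swap: "swap12 z \<in> N_ac a c \<longleftrightarrow> z \<in> N_ac (- a) c" for z a
    unfolding N_ac_def mem_Collect_eq swap12_nth mult.commute[of "z$2" "z$1"]
    by (auto simp del: times_complex.sel)
  show ?thesis
  proof (intro equalityI subsetI)
    fix z assume "z \<in> N_ac (- a) c"
    then show "z \<in> swap12 ` N_ac a c"
      by (intro image_eqI[of _ _ "swap12 z"]) (simp_all add: swap)
  qed (auto simp: swap)
qed

lemma SL_tangent_map_swap12:
  assumes "SL_tangent_map T"
  shows "SL_tangent_map (\<lambda>x. swap12 (T x))"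
proof -
  have "omega_C3 (swap12 u) (swap12 v) = omega_C3 u v" for u v
    by (simp add: omega_C3_def sum_3)
  moreover have "Omega_C3 (swap12 u) (swap12 v) (swap12 w) = - Omega_C3 u v w" for u v w
    by (simp add: Omega_C3_expand algebra_simps)
  moreover have "inj (\<lambda>x. swap12 (T x))"
    using assms inj_compose[OF inj_swap12, of T] by (simp add: SL_tangent_map_def o_def)
  ultimately show ?thesis
    using assms by (simp add: SL_tangent_map_def)
qed

lemma N_ac_first_nonzero_pos: "a > 0 \<Longrightarrow> N_ac a c \<inter> {z. z$1 \<noteq> 0} = N_ac a c"
  by (auto simp: N_ac_def add_nonneg_eq_0_iff)

lemma nonsingular_SL3_N_ac:
  assumes "a \<noteq> 0"
  shows "nonsingular_SL3 (N_ac a c)"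
proof -
  have pos: "SL_submanifold (N_ac b c)" if "b > 0" for b
    using SL_submanifold_N_ac_first_nonzero[of b c] that by (simp add: N_ac_first_nonzero_pos)
  have "SL_submanifold (N_ac a c)"
  proof (cases "a > 0")
    case False
    then have "- a > 0" using assms by simp
    have "SL_submanifold (swap12 ` N_ac (- a) c)"
      by (rule SL_submanifold_linear_image[OF pos[OF \<open>- a > 0\<close>] linear_swap12 linear_swap12])
        (simp_all add: SL_tangent_map_swap12)
    then show ?thesis by (simp flip: N_ac_uminus)
  qed (rule pos)
  then show ?thesis by (simp add: nonsingular_SL3_def closed_N_ac)
qed

lemma diffeomorphic_N_ac_pos:
  assumes "a > 0"
  shows "diffeomorphic (N_ac a c) (sphere (0::complex) 1 \<times> (UNIV :: (real^2) set))"
proof -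
  have "N_domain a = sphere 0 1 \<times> UNIV"
    using assms by (auto simp: N_domain_def add_nonneg_pos)
  moreover have "N_param a c ` N_domain a = N_ac a c"
    using homeomorphism_image1[OF homeomorphism_N_param] assms by (simp add: N_ac_first_nonzero_pos)
  ultimately have fibre: "diffeomorphic (sphere (0::complex) 1 \<times> (UNIV :: complex set)) (N_ac a c)"
    using diffeomorphic_N_param_image[of a "N_domain a" c] assms by simp
  obtain f :: "complex \<Rightarrow> real^2" and g where f: "linear f" "\<And>x. g (f x) = x" "\<And>y. f (g y) = y"
    by (rule isomorphisms_UNIV_UNIV[where 'M = complex and 'N = "real^2"]) auto
  have "inj f" "surj f"
    by (rule inj_on_inverseI[of _ g], rule f(2)) (rule surjI[of f g], rule f(3))
  then have "diffeomorphic (sphere (0::complex) 1 \<times> (UNIV :: complex set))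
      (sphere (0::complex) 1 \<times> (UNIV :: (real^2) set))"
    using diffeomorphic_Times_linear_image[OF f(1), of "sphere 0 1" UNIV] by simp
  with diffeomorphic_sym[OF fibre] show ?thesis by (rule diffeomorphic_trans)
qed

lemma diffeomorphic_N_ac:
  assumes "a \<noteq> 0"
  shows "diffeomorphic (N_ac a c) (sphere (0::complex) 1 \<times> (UNIV :: (real^2) set))"
proof (cases "a > 0")
  case False
  then have "- a > 0" using assms by simp
  have "diffeomorphic (N_ac (- a) c) (N_ac a c)"
    using diffeomorphic_linear_image[OF linear_swap12 inj_swap12] N_ac_uminus[of "- a" c] by simp
  from diffeomorphic_trans[OF diffeomorphic_sym[OF this] diffeomorphic_N_ac_pos[OF \<open>- a > 0\<close>]]
  show ?thesis .
qed (rule diffeomorphic_N_ac_pos)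

section \<open>The cone over the torus\<close>

lemma N_0_iff: "z \<in> N_ac 0 c \<longleftrightarrow> cmod (z$1) = cmod (z$2) \<and> z$3 = c + cnj (sgn (z$1) * z$2)"
  by (simp add: N_ac_nonneg_iff power2_eq_iff_nonneg)

lemma vertex_in_N_0: "vector [0, 0, c] \<in> N_ac 0 c"
  by (simp add: N_0_iff)

lemma N_0_first_nonzero: "N_ac 0 c \<inter> {z. z$1 \<noteq> 0} = N_ac 0 c - {vector [0, 0, c]}"
  by (auto simp: N_0_iff vec_eq_iff forall_3)

lemma N_0_dilation:
  assumes "z \<in> N_ac 0 c" "t \<ge> 0"
  shows "vector [0, 0, c] + t *\<^sub>R (z - vector [0, 0, c]) \<in> N_ac 0 c"
proof -
  let ?w = "vector [0, 0, c] + t *\<^sub>R (z - vector [0, 0, c]) :: complex^3"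
  have w: "?w $ 1 = t *\<^sub>R z$1" "?w $ 2 = t *\<^sub>R z$2" "?w $ 3 = c + t *\<^sub>R (z$3 - c)"
    by simp_all
  show ?thesis
    using assms unfolding N_0_iff w by (cases "t = 0") (simp_all add: sgn_scaleR)
qed

lemma N_0_vertex_singular:
  assumes "open U" "vector [0, 0, c] \<in> U"
  shows "\<not> SL_submanifold (N_ac 0 c \<inter> U)"
proof
  let ?p = "vector [0, 0, c] :: complex^3"
  assume SL: "SL_submanifold (N_ac 0 c \<inter> U)"
  have tangent: "v \<in> curve_tangents (N_ac 0 c \<inter> U) ?p" if "?p + v \<in> N_ac 0 c" for v
    using curve_tangents_Int_open[OF assms ray_in_curve_tangents] N_0_dilation[OF that] by simp
  have "vector [1, 1, 1] \<in> curve_tangents (N_ac 0 c \<inter> U) ?p"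
      "vector [\<i>, \<i>, -1] \<in> curve_tangents (N_ac 0 c \<inter> U) ?p"
    by (rule tangent; simp add: N_0_iff sgn_eq)+
  then have "omega_C3 (vector [1, 1, 1]) (vector [\<i>, \<i>, -1]) = 0"
    using vertex_in_N_0 assms(2) by (intro SL_submanifold_curve_tangents_omega[OF SL, of ?p]) auto
  then show False by (simp add: omega_C3_def sum_3)
qed

lemma SL_submanifold_N_0: "SL_submanifold (N_ac 0 c - {vector [0, 0, c]})"
  using SL_submanifold_N_ac_first_nonzero[of 0 c] by (simp add: N_0_first_nonzero)

lemma singular_points_N_0: "singular_points (N_ac 0 c) = {vector [0, 0, c]}"
proof
  show "singular_points (N_ac 0 c) \<subseteq> {vector [0, 0, c]}"
    using SL_submanifold_N_0[of c]
    by (auto simp: singular_points_def Diff_eq dest: spec[of _ "- {vector [0, 0, c]}"])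
  show "{vector [0, 0, c]} \<subseteq> singular_points (N_ac 0 c)"
    using N_0_vertex_singular vertex_in_N_0 by (auto simp: singular_points_def)
qed

lemma N_0_link:
  "N_ac 0 c \<inter> sphere (vector [0, 0, c]) 1 = N_param 0 c ` (sphere 0 1 \<times> sphere 0 (1 / sqrt 3))"
proof -
  let ?p = "vector [0, 0, c] :: complex^3"
  have dist: "dist ?p (N_param 0 c x) = sqrt 3 * cmod (snd x)" if "x \<in> N_domain 0" for x
  proof -
    have "dist ?p (N_param 0 c x) = sqrt (3 * (cmod (snd x))\<^sup>2)"
      using that
      by (auto simp: N_domain_def N_param_def dist_norm norm_vec_def L2_set_def sum_3 norm_mult)
    then show ?thesis by (simp add: real_sqrt_mult)
  qed
  have "N_ac 0 c \<inter> sphere ?p 1 = (N_ac 0 c \<inter> {z. z$1 \<noteq> 0}) \<inter> sphere ?p 1"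
    unfolding N_0_first_nonzero by auto
  also have "\<dots> = N_param 0 c ` N_domain 0 \<inter> sphere ?p 1"
    using homeomorphism_image1[OF homeomorphism_N_param[of 0 c]] by simp
  also have "\<dots> = N_param 0 c ` (N_domain 0 \<inter> {x. sqrt 3 * cmod (snd x) = 1})"
    using dist by auto
  also have "N_domain 0 \<inter> {x. sqrt 3 * cmod (snd x) = 1} = sphere 0 1 \<times> sphere 0 (1 / sqrt 3)"
    by (auto simp: N_domain_def field_simps)
  finally show ?thesis .
qed

lemma diffeomorphic_N_0_link: "diffeomorphic (N_ac 0 c \<inter> sphere (vector [0, 0, c]) 1) torus2"
proof -
  let ?S = "sphere 0 1 \<times> sphere 0 (1 / sqrt 3) :: (complex \<times> complex) set"
  have "?S \<subseteq> N_domain 0"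
    by (auto simp: N_domain_def)
  from diffeomorphic_N_param_image[OF order_refl this]
  have link: "diffeomorphic ?S (N_ac 0 c \<inter> sphere (vector [0, 0, c]) 1)"
    unfolding N_0_link .
  have "linear (\<lambda>u::complex. sqrt 3 *\<^sub>R u)" "inj (\<lambda>u::complex. sqrt 3 *\<^sub>R u)"
    by (auto intro!: linearI simp: algebra_simps inj_def)
  from diffeomorphic_Times_linear_image[OF this, of "sphere 0 1" "sphere 0 (1 / sqrt 3)"]
  have "diffeomorphic ?S torus2"
    by (simp add: torus2_def sphere_scale)
  with diffeomorphic_sym[OF link] show ?thesis by (rule diffeomorphic_trans)
qed

lemma SL_T2_cone_N_0: "SL_T2_cone (vector [0, 0, c]) (N_ac 0 c)"
  unfolding SL_T2_cone_def singular_SL3_def singular_points_N_0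
  using closed_N_ac SL_submanifold_N_0 N_0_dilation diffeomorphic_N_0_link by auto

lemma SL_fibration_F_fib: "SL_fibration UNIV F_fib UNIV"
proof -
  have "singular_SL3 (N_ac a c)" for a c
    using nonsingular_SL3_imp_singular_SL3[OF nonsingular_SL3_N_ac] SL_T2_cone_N_0
    by (cases "a = 0") (auto simp: SL_T2_cone_def)
  then show ?thesis
    by (auto simp: SL_fibration_def continuous_F_fib surj_F_fib F_fib_eq_iff)
qed

theorem theorem5p1:
  shows "(\<forall>a c. a \<noteq> 0 \<longrightarrow>
            nonsingular_SL3 (N_ac a c) \<and>
            diffeomorphic (N_ac a c) (sphere (0::complex) 1 \<times> (UNIV :: (real^2) set)))
       \<and> (\<forall>c. SL_T2_cone (vector [0, 0, c]) (N_ac 0 c) \<and>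
               singular_points (N_ac 0 c) = {vector [0, 0, c]})
       \<and> (\<forall>z::complex^3. let a = ((cmod (z$1))\<^sup>2 - (cmod (z$2))\<^sup>2) / 2 in
              length (filter id [a = 0 \<and> z$1 = 0 \<and> z$2 = 0, a \<ge> 0 \<and> z$1 \<noteq> 0, a < 0]) = 1)
       \<and> (\<forall>a c. F_fib -` {(a, c)} = N_ac a c)
       \<and> SL_fibration UNIV F_fib UNIV
       \<and> (\<exists>g1 g2 :: complex^3 \<Rightarrow> real \<times> complex.
            smooth_on {z. z$1 \<noteq> 0} g1 \<and> smooth_on {z. z$2 \<noteq> 0} g2 \<and>
            (\<forall>z. cmod (z$1) \<ge> cmod (z$2) \<and> z$1 \<noteq> 0 \<longrightarrow> F_fib z = g1 z) \<and>
            (\<forall>z. cmod (z$1) \<le> cmod (z$2) \<and> z$2 \<noteq> 0 \<longrightarrow> F_fib z = g2 z))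
       \<and> (\<forall>z. cmod (z$1) = cmod (z$2) \<longrightarrow> \<not> smooth_at F_fib z)"
  by (intro conjI allI impI nonsingular_SL3_N_ac diffeomorphic_N_ac SL_T2_cone_N_0 singular_points_N_0
      F_fib_cases_exclusive vimage_F_fib SL_fibration_F_fib F_fib_piecewise_smooth F_fib_not_smooth_at)

end
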